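(* Let $\Omega\subset\mathbb{R}^d$ ($d=2$ or $d=3$) be a bounded Lipschitz domain, let assumptions (A1)-(A3) listed in the context hold, and let $u\in H_0^1(\Omega)$ and $u_h\in V_h$ be solutions of $$a(u,v)+(b(u),v)=(f,v)\quad\forall v\in H_0^1(\Omega),\qquad a(u_h,v)+(b(u_h),v)=(f,v)\quad\forall v\in V_h,$$ respectively. Assume that there exists a constant $C_L$ such that $$(b(u)-b(u_h),v)\le C_L\,\|\nabla(u-u_h)\|_{0,2}\,\|\nabla v\|_{0,2},\qquad\forall v\in H_0^1(\Omega).$$ Then $$|||u-u_h|||\le\Big(1+\frac{C_L}{m}\Big)\inf_{v\in V_h}|||u-v|||.$$
   Context: Notation: $\|\cdot\|_{0,p}$ is the $L^p(\Omega)$ norm; $(v,w)=\int_\Omega vw\,dx$; $a(v,w)=\int_\Omega D\nabla v\cdot\nabla w\,dx$; $|||v|||=\sqrt{a(v,v)}$ is the induced energy norm. One writes $b(u)$ for $b(x,u(x))$, and $b'$ denotes the derivative of $b$ with respect to its second argument. The underlying problem is $-\nabla\cdot(D\nabla u)+b(x,u)=f$ in $\Omega$, with zero Dirichlet data. Assumptions. (A1) The diffusion tensor $D:\Omega\to\mathbb{R}^{d\times d}$ is in $L^\infty(\Omega)$ and $m|\xi|^2\le \xi^TD\xi\le M|\xi|^2$ for all $\xi\in\mathbb{R}^d$, for some constants $m,M>0$. (A2) $f\in L^2(\Omega)$ (and the Dirichlet datum is $g\equiv 0$). (A3) $b:\Omega\times\mathbb{R}\to\mathbb{R}$ is a Carathéodory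 function: $b(\cdot,\xi)$ is measurable on $\Omega$ for each $\xi\in\mathbb{R}$ and $b(x,\cdot)$ is smooth for each $x\in\Omega$; moreover $b'(\xi)\ge 0$ for all $\xi\in\mathbb{R}$ and $b(0)\equiv 0$. Finite elements: $\mathcal{T}_h$ is a quasi-uniform triangulation of $\Omega$ with mesh size $h$ (no angle condition beyond quasi-uniformity is imposed), and $V_h=\{v\in H_0^1(\Omega): v|_T\in\mathbb{P}_k(T)\ \forall T\in\mathcal{T}_h\}$, where $\mathbb{P}_k(T)$ is the space of polynomials of degree $\le k$ on $T$, with $k\ge 1$ fixed.
   Formalization: The diffusion tensor D is additionally assumed symmetric almost everywhere; without symmetry the claim fails (e.g. b = 0, C_L = 0, D = I + x_1 J with J the rotation by 90 degrees, on the unit square). *)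

theory Defs
  imports "HOL-Analysis.Analysis"
begin

section \<open>Lipschitz domains\<close>

text \<open>Near each boundary point, \<open>\<Omega>\<close> is the strict epigraph, in the direction of the unit vector \<open>e\<close>,
  of a Lipschitz function \<open>\<gamma>\<close> on the hyperplane orthogonal to \<open>e\<close>; the point
  \<open>x - (x \<bullet> e) *\<^sub>R e\<close> is the projection of \<open>x\<close> to that hyperplane.\<close>

definition lipschitz_boundary :: "'a::euclidean_space set \<Rightarrow> bool" where
  "lipschitz_boundary \<Omega> \<longleftrightarrow>
     (\<forall>z\<in>frontier \<Omega>. \<exists>e r L \<gamma>. norm e = 1 \<and> r > 0 \<and> L-lipschitz_on {y. y \<bullet> e = 0} \<gamma> \<and>
        \<Omega> \<inter> ball z r = {x \<in> ball z r. x \<bullet> e > (\<gamma> (x - (x \<bullet> e) *\<^sub>R e) :: real)})"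

definition bounded_lipschitz_domain :: "'a::euclidean_space set \<Rightarrow> bool" where
  "bounded_lipschitz_domain \<Omega> \<longleftrightarrow>
     open \<Omega> \<and> connected \<Omega> \<and> \<Omega> \<noteq> {} \<and> bounded \<Omega> \<and> lipschitz_boundary \<Omega>"

section \<open>Sobolev spaces\<close>

text \<open>Elements of the function spaces are represented by functions on the whole space of which
  only the values on \<open>\<Omega>\<close> matter, and all notions are invariant under changes on null sets.\<close>

definition L2 :: "(real^'d) set \<Rightarrow> (real^'d \<Rightarrow> 'b::euclidean_space) set" where
  "L2 \<Omega> = {v \<in> borel_measurable (lebesgue_on \<Omega>). integrable (lebesgue_on \<Omega>) (\<lambda>x. (norm (v x))\<^sup>2)}"

definition L2_inner :: "(real^'d) set \<Rightarrow> (real^'d \<Rightarrow> real) \<Rightarrow> (real^'d \<Rightarrow> real) \<Rightarrow> real" where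
  "L2_inner \<Omega> v w = (LINT x|lebesgue_on \<Omega>. v x * w x)"

definition L2_norm :: "(real^'d) set \<Rightarrow> (real^'d \<Rightarrow> 'b::euclidean_space) \<Rightarrow> real" where
  "L2_norm \<Omega> v = sqrt (LINT x|lebesgue_on \<Omega>. (norm (v x))\<^sup>2)"

definition partial_deriv :: "'d \<Rightarrow> (real^'d \<Rightarrow> real) \<Rightarrow> real^'d \<Rightarrow> real" where
  "partial_deriv i f x = frechet_derivative f (at x) (axis i 1)"

fun C_k :: "nat \<Rightarrow> (real^'d \<Rightarrow> real) \<Rightarrow> bool" where
  "C_k 0 f \<longleftrightarrow> continuous_on UNIV f"
| "C_k (Suc n) f \<longleftrightarrow> (\<forall>x. f differentiable (at x)) \<and> (\<forall>i. C_k n (partial_deriv i f))"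

definition test_function :: "(real^'d) set \<Rightarrow> (real^'d \<Rightarrow> real) \<Rightarrow> bool" where
  "test_function \<Omega> \<phi> \<longleftrightarrow>
     (\<forall>n. C_k n \<phi>) \<and> compact (closure {x. \<phi> x \<noteq> 0}) \<and> closure {x. \<phi> x \<noteq> 0} \<subseteq> \<Omega>"

definition locally_integrable :: "(real^'d) set \<Rightarrow> (real^'d \<Rightarrow> 'b::euclidean_space) \<Rightarrow> bool" where
  "locally_integrable \<Omega> v \<longleftrightarrow> (\<forall>K. compact K \<and> K \<subseteq> \<Omega> \<longrightarrow> v absolutely_integrable_on K)"

definition has_weak_gradient ::
  "(real^'d) set \<Rightarrow> (real^'d \<Rightarrow> real) \<Rightarrow> (real^'d \<Rightarrow> real^'d) \<Rightarrow> bool" where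
  "has_weak_gradient \<Omega> v g \<longleftrightarrow> locally_integrable \<Omega> v \<and> locally_integrable \<Omega> g \<and>
     (\<forall>\<phi> i. test_function \<Omega> \<phi> \<longrightarrow>
        (LINT x|lebesgue_on \<Omega>. v x * partial_deriv i \<phi> x) = - (LINT x|lebesgue_on \<Omega>. g x $ i * \<phi> x))"

text \<open>A representative of the weak gradient, which is unique up to null sets.\<close>

definition weak_grad :: "(real^'d) set \<Rightarrow> (real^'d \<Rightarrow> real) \<Rightarrow> real^'d \<Rightarrow> real^'d" where
  "weak_grad \<Omega> v = (SOME g. has_weak_gradient \<Omega> v g)"

definition H1 :: "(real^'d) set \<Rightarrow> (real^'d \<Rightarrow> real) set" where
  "H1 \<Omega> = {v \<in> L2 \<Omega>. \<exists>g \<in> L2 \<Omega>. has_weak_gradient \<Omega> v g}"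

definition H1_norm :: "(real^'d) set \<Rightarrow> (real^'d \<Rightarrow> real) \<Rightarrow> real" where
  "H1_norm \<Omega> v = sqrt ((L2_norm \<Omega> v)\<^sup>2 + (L2_norm \<Omega> (weak_grad \<Omega> v))\<^sup>2)"

definition H10 :: "(real^'d) set \<Rightarrow> (real^'d \<Rightarrow> real) set" where
  "H10 \<Omega> = {v \<in> H1 \<Omega>. \<exists>\<phi>. (\<forall>n. test_function \<Omega> (\<phi> n)) \<and>
     (\<lambda>n. H1_norm \<Omega> (\<lambda>x. v x - \<phi> n x)) \<longlonglongrightarrow> 0}"

section \<open>The boundary value problem\<close>

text \<open>Symmetry is part of the notion of a diffusion tensor: it makes the bilinear form
  \<open>energy_form\<close> an inner product, so that it induces the energy norm.\<close>

definition diffusion_tensor ::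
  "(real^'d) set \<Rightarrow> (real^'d \<Rightarrow> real^'d^'d) \<Rightarrow> real \<Rightarrow> real \<Rightarrow> bool" where
  "diffusion_tensor \<Omega> D m M \<longleftrightarrow> m > 0 \<and> M > 0 \<and>
     D \<in> borel_measurable (lebesgue_on \<Omega>) \<and> (\<exists>K. AE x in lebesgue_on \<Omega>. norm (D x) \<le> K) \<and>
     (AE x in lebesgue_on \<Omega>. transpose (D x) = D x) \<and>
     (AE x in lebesgue_on \<Omega>. \<forall>\<xi>. m * (norm \<xi>)\<^sup>2 \<le> \<xi> \<bullet> (D x *v \<xi>) \<and>
                                  \<xi> \<bullet> (D x *v \<xi>) \<le> M * (norm \<xi>)\<^sup>2)"

definition monotone_reaction :: "(real^'d) set \<Rightarrow> (real^'d \<Rightarrow> real \<Rightarrow> real) \<Rightarrow> bool" where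
  "monotone_reaction \<Omega> b \<longleftrightarrow>
     (\<forall>\<xi>. (\<lambda>x. b x \<xi>) \<in> borel_measurable (lebesgue_on \<Omega>)) \<and>
     (\<forall>x\<in>\<Omega>. \<forall>n \<xi>. (deriv ^^ n) (b x) differentiable (at \<xi>)) \<and>
     (\<forall>x\<in>\<Omega>. \<forall>\<xi>. deriv (b x) \<xi> \<ge> 0) \<and>
     (\<forall>x\<in>\<Omega>. b x 0 = 0)"

definition energy_form ::
  "(real^'d) set \<Rightarrow> (real^'d \<Rightarrow> real^'d^'d) \<Rightarrow> (real^'d \<Rightarrow> real) \<Rightarrow> (real^'d \<Rightarrow> real) \<Rightarrow> real" where
  "energy_form \<Omega> D v w = (LINT x|lebesgue_on \<Omega>. (D x *v weak_grad \<Omega> v x) \<bullet> weak_grad \<Omega> w x)"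

definition energy_norm ::
  "(real^'d) set \<Rightarrow> (real^'d \<Rightarrow> real^'d^'d) \<Rightarrow> (real^'d \<Rightarrow> real) \<Rightarrow> real" where
  "energy_norm \<Omega> D v = sqrt (energy_form \<Omega> D v v)"

text \<open>The Bochner integral of a non-integrable function is 0, so a pairing \<open>(b(u), v)\<close> has to be
  required to exist. The other two pairings exist by the assumptions on \<open>D\<close> and \<open>f\<close>.\<close>

definition pairing_exists :: "(real^'d) set \<Rightarrow> (real^'d \<Rightarrow> real) \<Rightarrow> (real^'d \<Rightarrow> real) \<Rightarrow> bool" where
  "pairing_exists \<Omega> v w \<longleftrightarrow> integrable (lebesgue_on \<Omega>) (\<lambda>x. v x * w x)"

definition galerkin_solution ::
  "(real^'d) set \<Rightarrow> (real^'d \<Rightarrow> real^'d^'d) \<Rightarrow> (real^'d \<Rightarrow> real \<Rightarrow> real) \<Rightarrow> (real^'d \<Rightarrow> real) \<Rightarrow>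
   (real^'d \<Rightarrow> real) set \<Rightarrow> (real^'d \<Rightarrow> real) \<Rightarrow> bool" where
  "galerkin_solution \<Omega> D b f V u \<longleftrightarrow> u \<in> V \<and>
     (\<forall>v\<in>V. pairing_exists \<Omega> (\<lambda>x. b x (u x)) v \<and>
        energy_form \<Omega> D u v + L2_inner \<Omega> (\<lambda>x. b x (u x)) v = L2_inner \<Omega> f v)"

section \<open>Finite elements\<close>

text \<open>The library notion of a triangulation is conforming, but allows simplices of any dimension
  and says nothing about their union.\<close>

definition triangulation_of :: "(real^'d) set \<Rightarrow> (real^'d) set set \<Rightarrow> bool" where
  "triangulation_of \<Omega> \<T> \<longleftrightarrow>
     triangulation \<T> \<and> (\<forall>T\<in>\<T>. int CARD('d) simplex T) \<and> \<Union>\<T> = closure \<Omega>"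

definition mesh_size :: "(real^'d) set set \<Rightarrow> real" where
  "mesh_size \<T> = Max (diameter ` \<T>)"

text \<open>Quasi-uniformity is a property of a family \<open>\<T>\<close> of triangulations, indexed by the mesh sizes
  \<open>h \<in> H\<close>: with a constant independent of \<open>h\<close>, every \<open>T \<in> \<T> h\<close> contains a ball of radius
  comparable to \<open>h\<close>.\<close>

definition quasi_uniform_triangulations ::
  "(real^'d) set \<Rightarrow> real set \<Rightarrow> (real \<Rightarrow> (real^'d) set set) \<Rightarrow> bool" where
  "quasi_uniform_triangulations \<Omega> H \<T> \<longleftrightarrow>
     (\<forall>h\<in>H. triangulation_of \<Omega> (\<T> h) \<and> mesh_size (\<T> h) = h) \<and>
     (\<exists>\<rho>>0. \<forall>h\<in>H. \<forall>T\<in>\<T> h. \<exists>z. cball z (\<rho> * h) \<subseteq> T)"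

definition polynomials :: "nat \<Rightarrow> (real^'d \<Rightarrow> real) set" where
  "polynomials k =
     {p. \<exists>c. \<forall>x. p x = (\<Sum>\<alpha> | (\<Sum>i\<in>UNIV. \<alpha> i) \<le> k. c \<alpha> * (\<Prod>i\<in>UNIV. (x $ i) ^ (\<alpha> i :: nat)))}"

definition fe_space :: "(real^'d) set \<Rightarrow> (real^'d) set set \<Rightarrow> nat \<Rightarrow> (real^'d \<Rightarrow> real) set" where
  "fe_space \<Omega> \<T> k =
     {v \<in> H10 \<Omega>. \<forall>T\<in>\<T>. \<exists>p\<in>polynomials k. AE x in lebesgue_on T. v x = p x}"

end

(* Put e = u - u_h, B = b(u) - b(u_h) and let v be in V_h. Galerkin orthogonality for the test function
   v - u_h = e - (u - v) gives a(e,e) = a(e,u-v) - (B,e) + (B,u-v). Monotonicity of b makes (B,e)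
   nonnegative, so Cauchy-Schwarz, the Lipschitz hypothesis and coercivity bound the right-hand side
   by (1 + C_L/m) |||e||| |||u-v|||.

   Since weak_grad is merely some weak gradient, even the linearity of the energy form rests on the
   almost-everywhere uniqueness of weak gradients; and H10 is closed under differences only because
   test functions have weak gradients (otherwise the gradients in the H1 norms would be junk). *)

theory Submission
  imports Defs
begin

section \<open>Smooth functions and bump functions\<close>

text \<open>Both summands of the constant can be traced: the 1 is Cauchy-Schwarz for a(e, u - v),
  while \<open>C\<^sub>L / m\<close> arises because the Lipschitz hypothesis carries two gradient
  norms, each at most the energy norm divided by sqrt m. The test function is
  \<open>v - u\<^sub>h\<close> and not e, since it must be admissible in the discrete equation as
  well. The larger obstacle is uniqueness of weak gradients. It amounts to the fact that a locally
  integrable function orthogonal to every test function vanishes almost everywhere, so sufficiently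
  many functions that are smooth in the sense of the recursive \<open>C_k\<close> have to be
  exhibited. Products of factors exp(-1/t) with affine arguments do this: they converge boundedly to
  indicators of boxes, so all integrals over boxes vanish, and averages over shrinking cubes recover
  the function at almost every point.\<close>

text \<open>The functions \<open>p(1/t) exp(-1/t)\<close> with \<open>p\<close> a polynomial form a class that is closed under
  differentiation.\<close>

definition exp_flat :: "real poly \<Rightarrow> real \<Rightarrow> real" where
  "exp_flat p t = (if t > 0 then poly p (1 / t) * exp (- (1 / t)) else 0)"

lemma tendsto_poly_exp_minus: "((\<lambda>y. poly p y * exp (- y)) \<longlongrightarrow> (0::real)) at_top"
proof -
  have "((\<lambda>y. \<Sum>i\<le>degree p. coeff p i * (y ^ i / exp y)) \<longlongrightarrow> (\<Sum>i\<le>degree p. coeff p i * 0)) at_top"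
    by (intro tendsto_intros tendsto_power_div_exp_0)
  then show ?thesis
    by (simp add: poly_altdef exp_minus divide_inverse sum_distrib_right mult.assoc)
qed

text \<open>With s = 1/t one has d/dt = -s^2 d/ds, which sends p(s) exp(-s) to s^2 (p - p')(s)
  exp(-s). The two \<open>pCons 0\<close> are the multiplication by s^2.\<close>

lemma DERIV_exp_flat:
  "(exp_flat p has_real_derivative exp_flat (pCons 0 (pCons 0 (p - pderiv p))) t) (at t)"
proof -
  consider "t > 0" | "t < 0" | "t = 0" by linarith
  then show ?thesis
  proof cases
    case 1
    have "((\<lambda>t. poly p (1 / t) * exp (- (1 / t))) has_real_derivative
        exp_flat (pCons 0 (pCons 0 (p - pderiv p))) t) (at t)"
      using 1 by (auto intro!: derivative_eq_intros DERIV_chain2[OF poly_DERIV]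
          simp: exp_flat_def field_simps power2_eq_square)
    then show ?thesis
      by (rule has_field_derivative_transform_within_open[of _ _ _ "{0<..}"])
         (use 1 in \<open>auto simp: exp_flat_def\<close>)
  next
    case 2
    have "((\<lambda>t. 0) has_real_derivative exp_flat (pCons 0 (pCons 0 (p - pderiv p))) t) (at t)"
      using 2 by (simp add: exp_flat_def)
    then show ?thesis
      by (rule has_field_derivative_transform_within_open[of _ _ _ "{..<0}"])
         (use 2 in \<open>auto simp: exp_flat_def\<close>)
  next
    case 3
    \<comment> \<open>The right difference quotient at 0 is p(1/h) exp(-1/h) / h; the extra factor
      1/h is absorbed into the polynomial \<open>pCons 0 p\<close>.\<close>
    have "((\<lambda>y. poly (pCons 0 p) y * exp (- y)) \<longlongrightarrow> 0) at_top"
      by (rule tendsto_poly_exp_minus)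
    then have "((\<lambda>h. poly (pCons 0 p) (inverse h) * exp (- inverse h)) \<longlongrightarrow> 0) (at_right 0)"
      by (rule filterlim_compose[OF _ filterlim_inverse_at_top_right])
    then have R: "((\<lambda>h. exp_flat p h / h) \<longlongrightarrow> 0) (at_right 0)"
      by (rule Lim_transform_eventually)
         (auto simp: eventually_at_right_field exp_flat_def divide_inverse intro!: exI[of _ 1])
    have "((\<lambda>h. 0 :: real) \<longlongrightarrow> 0) (at_left 0)"
      by simp
    then have L: "((\<lambda>h. exp_flat p h / h) \<longlongrightarrow> 0) (at_left 0)"
      by (rule Lim_transform_eventually)
         (auto simp: eventually_at_left_field exp_flat_def intro!: exI[of _ "-1"])
    show ?thesis
      using filterlim_split_at[OF L R] 3 by (simp add: DERIV_def exp_flat_def)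
  qed
qed

section \<open>Calculus of the classes \<open>C_k\<close>\<close>

lemma partial_deriv_eq:
  assumes "(f has_derivative f') (at x)"
  shows "partial_deriv i f x = f' (axis i 1)"
  using frechet_derivative_at[OF assms] by (simp add: partial_deriv_def)

text \<open>The recursion demands continuity only of the partial derivatives of the last order; at
  the lower orders it follows from differentiability.\<close>

lemma C_k_Suc_imp: "C_k (Suc n) f \<Longrightarrow> C_k n f"
proof (induction n arbitrary: f)
  case 0
  then show ?case
    by (auto simp: continuous_on_eq_continuous_at intro: differentiable_imp_continuous_within)
next
  case (Suc n)
  then show ?case by (metis C_k.simps(2))
qed

lemma C_k_const: "C_k n (\<lambda>x::real^'d. c)"
proof (induction n arbitrary: c)
  case (Suc n)
  have "partial_deriv i (\<lambda>x. c) = (\<lambda>x. 0)" for i :: 'd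
    by (auto simp: partial_deriv_eq[OF has_derivative_const])
  with Suc show ?case by simp
qed simp

lemma partial_deriv_add:
  assumes "f differentiable at x" "g differentiable at x"
  shows "partial_deriv i (\<lambda>x. f x + g x) x = partial_deriv i f x + partial_deriv i g x"
  using partial_deriv_eq[OF has_derivative_add[OF assms[unfolded frechet_derivative_works]]]
  by (simp add: partial_deriv_def)

lemma partial_deriv_diff:
  assumes "f differentiable at x" "g differentiable at x"
  shows "partial_deriv i (\<lambda>x. f x - g x) x = partial_deriv i f x - partial_deriv i g x"
  using partial_deriv_eq[OF has_derivative_diff[OF assms[unfolded frechet_derivative_works]]]
  by (simp add: partial_deriv_def)

lemma partial_deriv_mult:
  assumes "f differentiable at x" "g differentiable at x"
  shows "partial_deriv i (\<lambda>x. f x * g x) x = f x * partial_deriv i g x + partial_deriv i f x * g x"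
  using partial_deriv_eq[OF has_derivative_mult[OF assms[unfolded frechet_derivative_works]]]
  by (simp add: partial_deriv_def)

lemma C_k_add: "C_k n f \<Longrightarrow> C_k n g \<Longrightarrow> C_k n (\<lambda>x. f x + g x)"
proof (induction n arbitrary: f g)
  case (Suc n)
  then have "partial_deriv i (\<lambda>x. f x + g x) = (\<lambda>x. partial_deriv i f x + partial_deriv i g x)" for i
    by (auto simp: partial_deriv_add)
  with Suc show ?case by auto
qed (auto intro: continuous_on_add)

lemma C_k_diff: "C_k n f \<Longrightarrow> C_k n g \<Longrightarrow> C_k n (\<lambda>x. f x - g x)"
proof (induction n arbitrary: f g)
  case (Suc n)
  then have "partial_deriv i (\<lambda>x. f x - g x) = (\<lambda>x. partial_deriv i f x - partial_deriv i g x)" for i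
    by (auto simp: partial_deriv_diff)
  with Suc show ?case by auto
qed (auto intro: continuous_on_diff)

text \<open>The product rule leaves one factor undifferentiated, hence of class \<open>Suc n\<close>
  where the induction hypothesis wants \<open>n\<close>; \<open>C_k_Suc_imp\<close> lowers
  it.\<close>

lemma C_k_mult: "C_k n f \<Longrightarrow> C_k n g \<Longrightarrow> C_k n (\<lambda>x. f x * g x)"
proof (induction n arbitrary: f g)
  case (Suc n)
  then have "partial_deriv i (\<lambda>x. f x * g x)
      = (\<lambda>x. f x * partial_deriv i g x + partial_deriv i f x * g x)" for i
    by (auto simp: partial_deriv_mult)
  with Suc C_k_Suc_imp[OF Suc.prems(1)] C_k_Suc_imp[OF Suc.prems(2)] show ?case
    by (auto intro: C_k_add)
qed (auto intro: continuous_on_mult)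

lemma C_k_prod:
  assumes "finite A" "\<And>j. j \<in> A \<Longrightarrow> C_k n (f j)"
  shows "C_k n (\<lambda>x. \<Prod>j\<in>A. f j x)"
  using assms by (induction A rule: finite_induct) (auto intro: C_k_const C_k_mult)

text \<open>The induction has to run over all \<open>p\<close>, since each differentiation replaces
  \<open>p\<close> by another polynomial. The affine argument covers the rising side of a bump
  (\<open>c\<close> positive) as well as the falling one (\<open>c\<close> negative).\<close>

lemma C_k_exp_flat: "C_k n (\<lambda>x::real^'d. exp_flat p (c * (x $ j) + d))"
proof (induction n arbitrary: p)
  case 0
  have "continuous_on UNIV (exp_flat p)"
    by (meson DERIV_exp_flat DERIV_isCont continuous_at_imp_continuous_on)
  then show ?case
    by (auto intro!: continuous_intros continuous_on_compose2[of UNIV "exp_flat p"])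
next
  case (Suc n)
  define q where "q = pCons 0 (pCons 0 (p - pderiv p))"
  have der: "((\<lambda>x. exp_flat p (c * (x $ j) + d)) has_derivative
      (\<lambda>v. (c * (v $ j)) * exp_flat q (c * (x $ j) + d))) (at x)" for x :: "real^'d"
  proof -
    have "((\<lambda>x. c * (x $ j) + d) has_derivative (\<lambda>v. c * (v $ j))) (at x)"
      by (auto intro!: derivative_eq_intros bounded_linear_imp_has_derivative[OF bounded_linear_vec_nth])
    from has_derivative_compose[OF this DERIV_exp_flat[unfolded has_field_derivative_def]]
    show ?thesis by (simp add: q_def mult_ac)
  qed
  have "partial_deriv i (\<lambda>x. exp_flat p (c * (x $ j) + d)) =
      (\<lambda>x. (c * (axis i 1 $ j)) * exp_flat q (c * (x $ j) + d))" for i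
    by (simp add: partial_deriv_eq[OF der] fun_eq_iff)
  then show ?case
    using der Suc by (auto simp: differentiable_def intro: C_k_mult C_k_const)
qed

text \<open>Scaling the argument of \<open>exp(-1/t)\<close>, rather than mollifying, already makes these test functions
  converge to the indicator of the open box: \<open>exp(-1/(n t))\<close> tends to 1 for \<open>t > 0\<close>.\<close>

definition box_bump :: "real^'d \<Rightarrow> real^'d \<Rightarrow> nat \<Rightarrow> real^'d \<Rightarrow> real" where
  "box_bump a b n x = (\<Prod>i\<in>UNIV. exp_flat 1 (real (Suc n) * (x $ i - a $ i)) *
      exp_flat 1 (real (Suc n) * (b $ i - x $ i)))"

lemma box_bump_eq_0: "x \<notin> box a b \<Longrightarrow> box_bump a b n x = 0"
proof -
  assume "x \<notin> box a b"
  then obtain i where "x $ i - a $ i \<le> 0 \<or> b $ i - x $ i \<le> 0"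
    by (auto simp: mem_box_cart not_less)
  then have "exp_flat 1 (real (Suc n) * (x $ i - a $ i)) *
      exp_flat 1 (real (Suc n) * (b $ i - x $ i)) = 0"
    unfolding exp_flat_def by (smt (verit) mult_eq_0_iff of_nat_0_le_iff mult_nonneg_nonpos)
  then show ?thesis
    unfolding box_bump_def by (intro prod_zero) auto
qed

lemma exp_flat_1_bounds: "0 \<le> exp_flat 1 t" "exp_flat 1 t \<le> 1"
  by (auto simp: exp_flat_def)

lemma box_bump_bounds: "0 \<le> box_bump a b n x" "box_bump a b n x \<le> 1"
  unfolding box_bump_def
  by (auto intro!: prod_nonneg prod_le_1 mult_nonneg_nonneg mult_le_one exp_flat_1_bounds)

lemma exp_flat_1_scaled_tendsto:
  assumes "t > 0"
  shows "(\<lambda>n. exp_flat 1 (real (Suc n) * t)) \<longlonglongrightarrow> 1"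
proof -
  have "(\<lambda>n. exp (- (inverse (real (Suc n)) * (1 / t)))) \<longlonglongrightarrow> exp (- (0 * (1/t)))"
    by (intro tendsto_intros LIMSEQ_inverse_real_of_nat)
  moreover have "exp_flat 1 (real (Suc n) * t) = exp (- (inverse (real (Suc n)) * (1 / t)))" for n
    using assms unfolding exp_flat_def by (subst if_P) (simp_all add: divide_inverse del: of_nat_Suc)
  ultimately show ?thesis by simp
qed

lemma box_bump_tendsto: "(\<lambda>n. box_bump a b n x) \<longlonglongrightarrow> indicator (box a b) x"
proof (cases "x \<in> box a b")
  case True
  then have *: "0 < x $ i - a $ i" "0 < b $ i - x $ i" for i
    by (auto simp: mem_box_cart)
  have "(\<lambda>n. \<Prod>i\<in>UNIV. exp_flat 1 (real (Suc n) * (x $ i - a $ i)) *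
      exp_flat 1 (real (Suc n) * (b $ i - x $ i))) \<longlonglongrightarrow> (\<Prod>i\<in>(UNIV::'a set). 1 * 1)"
    by (intro tendsto_intros exp_flat_1_scaled_tendsto *)
  then show ?thesis
    using True by (simp add: box_bump_def)
qed (simp add: box_bump_eq_0)

text \<open>The bump is zero off the open box, but the support in \<open>test_function\<close> is a
  closure; hence it is the closed box that has to lie in \<open>\<Omega>\<close>.\<close>

lemma test_function_box_bump:
  fixes a b :: "real^'d"
  assumes "cbox a b \<subseteq> \<Omega>"
  shows "test_function \<Omega> (box_bump a b n)"
proof -
  have "{x. box_bump a b n x \<noteq> 0} \<subseteq> box a b"
    using box_bump_eq_0 by blast
  then have "closure {x. box_bump a b n x \<noteq> 0} \<subseteq> cbox a b"
    by (meson box_subset_cbox closed_cbox closure_minimal order_trans)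
  moreover have "C_k m (box_bump a b n)" for m
  proof -
    have "C_k m (\<lambda>x. exp_flat 1 (real (Suc n) * (x $ i - a $ i)))"
      "C_k m (\<lambda>x. exp_flat 1 (real (Suc n) * (b $ i - x $ i)))" for i
      using C_k_exp_flat[of m 1 "real (Suc n)" i "- real (Suc n) * (a $ i)"]
        C_k_exp_flat[of m 1 "- real (Suc n)" i "real (Suc n) * (b $ i)"]
      by (simp_all add: right_diff_distrib del: of_nat_Suc)
    then show ?thesis
      unfolding box_bump_def by (intro C_k_prod C_k_mult) auto
  qed
  ultimately show ?thesis
    using assms unfolding test_function_def
    by (auto simp: compact_eq_bounded_closed intro: bounded_subset[OF bounded_cbox])
qed

section \<open>Weak gradients\<close>

lemma sets_lebesgue_open: "open S \<Longrightarrow> S \<in> sets lebesgue"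
  by (simp add: borel_open sets_completionI_sets)

lemma integrable_lebesgue_on_support:
  fixes f :: "'a::euclidean_space \<Rightarrow> 'b::euclidean_space"
  assumes "\<Omega> \<in> sets lebesgue" "K \<in> sets lebesgue" "K \<subseteq> \<Omega>" "\<And>x. x \<in> \<Omega> - K \<Longrightarrow> f x = 0"
  shows "integrable (lebesgue_on \<Omega>) f \<longleftrightarrow> integrable (lebesgue_on K) f"
proof -
  have "(\<lambda>x. indicator \<Omega> x *\<^sub>R f x) = (\<lambda>x. indicator K x *\<^sub>R f x)"
    using assms by (fastforce simp: indicator_def fun_eq_iff)
  then show ?thesis
    using assms by (simp add: integrable_restrict_space)
qed

text \<open>On \<open>K\<close> the factor \<open>\<psi>\<close> is bounded and \<open>v\<close> is
  integrable; off \<open>K\<close> the product is zero. This makes the integrals in the definition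
  of a weak gradient genuine, so that they may be added and subtracted.\<close>

lemma locally_integrable_mult_integrable:
  fixes v \<psi> :: "real^'d \<Rightarrow> real"
  assumes "open \<Omega>" "locally_integrable \<Omega> v" "continuous_on UNIV \<psi>" "compact K" "K \<subseteq> \<Omega>"
    "\<And>x. x \<notin> K \<Longrightarrow> \<psi> x = 0"
  shows "integrable (lebesgue_on \<Omega>) (\<lambda>x. v x * \<psi> x)"
proof -
  have K: "K \<in> sets lebesgue"
    using \<open>compact K\<close> by (simp add: borel_compact sets_completionI_sets)
  have c: "continuous_on K \<psi>"
    using assms(3) continuous_on_subset by blast
  have "(\<lambda>x. \<psi> x * v x) absolutely_integrable_on K"
  proof (rule absolutely_integrable_bounded_measurable_product[OF bilinear_times])
    show "\<psi> \<in> borel_measurable (lebesgue_on K)"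
      by (rule continuous_imp_measurable_on_sets_lebesgue[OF c K])
    show "bounded (\<psi> ` K)"
      using c \<open>compact K\<close> compact_continuous_image compact_imp_bounded by blast
  qed (use assms K in \<open>auto simp: locally_integrable_def\<close>)
  then have "integrable (lebesgue_on K) (\<lambda>x. v x * \<psi> x)"
    using K by (simp add: integrable_restrict_space set_integrable_def mult.commute)
  then show ?thesis
    using integrable_lebesgue_on_support[of \<Omega> K "\<lambda>x. v x * \<psi> x"] assms K
    by (simp add: borel_open sets_completionI_sets)
qed

lemma continuous_locally_integrable:
  fixes f :: "real^'d \<Rightarrow> 'b::euclidean_space"
  assumes "continuous_on UNIV f"
  shows "locally_integrable \<Omega> f"
  unfolding locally_integrable_def
proof safe
  fix K :: "(real^'d) set" assume K: "compact K"
  then have "integrable lborel (\<lambda>x. indicator K x *\<^sub>R f x)"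
    using assms by (intro borel_integrable_compact) (auto intro: continuous_on_subset)
  then show "f absolutely_integrable_on K"
    using assms K unfolding set_integrable_def
    by (subst integrable_completion)
       (auto intro!: borel_measurable_continuous_on_indicator borel_measurable_scaleR borel_measurable_continuous_onI
             simp: borel_compact)
qed

text \<open>The complement of the closed support is open and \<open>\<phi>\<close> is zero on it, so
  the derivatives vanish there too and one \<open>K\<close> serves for both.\<close>

lemma test_function_support:
  fixes \<phi> :: "real^'d \<Rightarrow> real"
  assumes "test_function \<Omega> \<phi>"
  obtains K where "compact K" "K \<subseteq> \<Omega>" "\<And>x. x \<notin> K \<Longrightarrow> \<phi> x = 0"
    "\<And>x i. x \<notin> K \<Longrightarrow> partial_deriv i \<phi> x = 0"
proof
  let ?K = "closure {x. \<phi> x \<noteq> 0}"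
  show "compact ?K" "?K \<subseteq> \<Omega>"
    using assms by (auto simp: test_function_def)
  show 0: "\<phi> x = 0" if "x \<notin> ?K" for x
    using that closure_subset[of "{x. \<phi> x \<noteq> 0}"] by auto
  show "partial_deriv i \<phi> x = 0" if "x \<notin> ?K" for x i
  proof -
    have "((\<lambda>x. 0 :: real) has_derivative (\<lambda>v. 0)) (at x)"
      by simp
    moreover have "open (- ?K)"
      by (simp only: open_Compl closed_closure)
    moreover have "x \<in> - ?K"
      using that by simp
    ultimately have "(\<phi> has_derivative (\<lambda>v. 0)) (at x)"
      by (rule has_derivative_transform_within_open) (metis 0 ComplD)
    then show ?thesis by (simp add: partial_deriv_eq)
  qed
qed

lemma test_function_smooth:
  assumes "test_function \<Omega> \<phi>"
  shows "continuous_on UNIV \<phi>" "\<phi> differentiable at x" "continuous_on UNIV (partial_deriv i \<phi>)"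
proof -
  have "C_k 0 \<phi>" "C_k (Suc 0) \<phi>"
    using assms by (auto simp: test_function_def simp del: C_k.simps)
  then show "continuous_on UNIV \<phi>" "\<phi> differentiable at x" "continuous_on UNIV (partial_deriv i \<phi>)"
    by auto
qed

lemma test_function_diff:
  assumes "test_function \<Omega> \<phi>" "test_function \<Omega> \<psi>"
  shows "test_function \<Omega> (\<lambda>x. \<phi> x - \<psi> x)"
proof -
  have sub: "closure {x. \<phi> x - \<psi> x \<noteq> 0} \<subseteq> closure {x. \<phi> x \<noteq> 0} \<union> closure {x. \<psi> x \<noteq> 0}"
    unfolding closure_Un[symmetric] by (rule closure_mono) auto
  have "compact (closure {x. \<phi> x \<noteq> 0} \<union> closure {x. \<psi> x \<noteq> 0})"
    using assms by (auto simp: test_function_def intro: compact_Un)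
  then have "compact (closure {x. \<phi> x - \<psi> x \<noteq> 0})"
    using sub by (meson bounded_subset closed_closure compact_eq_bounded_closed)
  with sub show ?thesis
    using assms unfolding test_function_def by (auto intro: C_k_diff)
qed

lemma locally_integrable_diff:
  assumes "locally_integrable \<Omega> v" "locally_integrable \<Omega> w"
  shows "locally_integrable \<Omega> (\<lambda>x. v x - w x)"
  using assms by (auto simp: locally_integrable_def intro: set_integral_diff)

lemma locally_integrable_component:
  fixes g :: "real^'d \<Rightarrow> real^'d"
  assumes "locally_integrable \<Omega> g"
  shows "locally_integrable \<Omega> (\<lambda>x. g x $ i)"
proof -
  have "(\<lambda>x. g x \<bullet> axis i 1) absolutely_integrable_on K" if "g absolutely_integrable_on K" for K
    using that by (rule absolutely_integrable_component)
  then show ?thesis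
    using assms by (simp add: locally_integrable_def inner_axis)
qed

text \<open>Subtracting the two defining identities is legitimate only for integrable integrands;
  the compact support of the test function supplies integrability of all four.\<close>

lemma has_weak_gradient_diff:
  assumes "open \<Omega>" and v: "has_weak_gradient \<Omega> v g" and w: "has_weak_gradient \<Omega> w h"
  shows "has_weak_gradient \<Omega> (\<lambda>x. v x - w x) (\<lambda>x. g x - h x)"
  unfolding has_weak_gradient_def
proof (intro conjI allI impI)
  show "locally_integrable \<Omega> (\<lambda>x. v x - w x)" "locally_integrable \<Omega> (\<lambda>x. g x - h x)"
    using v w by (auto simp: has_weak_gradient_def intro: locally_integrable_diff)
  fix \<phi> i assume t: "test_function \<Omega> \<phi>"
  obtain K where K: "compact K" "K \<subseteq> \<Omega>" "\<And>x. x \<notin> K \<Longrightarrow> \<phi> x = 0"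
    "\<And>x i. x \<notin> K \<Longrightarrow> partial_deriv i \<phi> x = 0"
    using test_function_support[OF t] by metis
  note int = locally_integrable_mult_integrable[OF \<open>open \<Omega>\<close> _ _ K(1,2)]
  have "integrable (lebesgue_on \<Omega>) (\<lambda>x. v x * partial_deriv i \<phi> x)"
    "integrable (lebesgue_on \<Omega>) (\<lambda>x. w x * partial_deriv i \<phi> x)"
    "integrable (lebesgue_on \<Omega>) (\<lambda>x. g x $ i * \<phi> x)"
    "integrable (lebesgue_on \<Omega>) (\<lambda>x. h x $ i * \<phi> x)"
    using v w K test_function_smooth[OF t]
    by (auto simp: has_weak_gradient_def intro!: int locally_integrable_component)
  moreover have "(LINT x|lebesgue_on \<Omega>. v x * partial_deriv i \<phi> x) = - (LINT x|lebesgue_on \<Omega>. g x $ i * \<phi> x)"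
    "(LINT x|lebesgue_on \<Omega>. w x * partial_deriv i \<phi> x) = - (LINT x|lebesgue_on \<Omega>. h x $ i * \<phi> x)"
    using v w t unfolding has_weak_gradient_def by blast+
  ultimately show "(LINT x|lebesgue_on \<Omega>. (v x - w x) * partial_deriv i \<phi> x)
      = - (LINT x|lebesgue_on \<Omega>. (g x - h x) $ i * \<phi> x)"
    by (simp add: left_diff_distrib)
qed

text \<open>At almost every point the integrable function is the limit of its averages over small cubes.\<close>

lemma negligible_if_integral_box_zero:
  fixes f :: "'a::euclidean_space \<Rightarrow> real"
  assumes "f absolutely_integrable_on cbox a b"
    and zero: "\<And>c d. cbox c d \<subseteq> cbox a b \<Longrightarrow> (LINT x|lebesgue_on \<Omega>. f x * indicator (box c d) x) = 0"
    and "cbox a b \<subseteq> \<Omega>" "\<Omega> \<in> sets lebesgue"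
  shows "negligible {x \<in> cbox a b. f x \<noteq> 0}"
proof -
  define F where "F x = (if x \<in> cbox a b then f x else 0)" for x
  have "F absolutely_integrable_on UNIV"
    unfolding F_def using assms(1) by (simp add: absolutely_integrable_restrict_UNIV)
  then have F: "F absolutely_integrable_on cbox c d" for c d
    by (rule set_integrable_subset) auto
  then have "F integrable_on cbox c d" for c d
    by (rule set_lebesgue_integral_eq_integral)
  from integrable_ccontinuous_explicit[OF this] obtain N where N: "negligible N"
    "\<And>x e. \<lbrakk>x \<notin> N; 0 < e\<rbrakk> \<Longrightarrow> \<exists>d>0. \<forall>h. 0 < h \<and> h < d \<longrightarrow>
        norm (integral (cbox x (x + h *\<^sub>R One)) F /\<^sub>R h ^ DIM('a) - F x) < e"
    by blast
  \<comment> \<open>The assumption speaks of open boxes, the differentiation theorem of closed ones;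
    the integrals agree because the boundary is negligible.\<close>
  have I0: "integral (cbox c d) F = 0" if sub: "cbox c d \<subseteq> cbox a b" for c d
  proof -
    have "F absolutely_integrable_on box c d"
      using F[of c d] by (rule set_integrable_subset) (auto simp: box_subset_cbox)
    then have "integral (box c d) F = (LINT x|lebesgue. indicator (box c d) x * F x)"
      by (simp add: set_lebesgue_integral_eq_integral(2)[symmetric] set_lebesgue_integral_def)
    also have "(\<lambda>x. indicator (box c d) x * F x) = (\<lambda>x. indicator \<Omega> x *\<^sub>R (f x * indicator (box c d) x))"
      using sub assms(3) box_subset_cbox[of c d] by (auto simp: F_def indicator_def fun_eq_iff)
    also have "(LINT x|lebesgue. \<dots> x) = (LINT x|lebesgue_on \<Omega>. f x * indicator (box c d) x)"
      using assms(4) by (simp add: integral_restrict_space)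
    also have "\<dots> = 0"
      using zero[OF sub] .
    finally show ?thesis
      by (simp add: integral_open_interval)
  qed
  \<comment> \<open>At an interior point a small cube with lower corner \<open>x\<close> stays
    inside the box. Its average is 0, which contradicts an approximation of \<open>F x\<close> with
    error below \<open>norm (F x)\<close>.\<close>
  have "f x = 0" if x: "x \<in> box a b" "x \<notin> N" for x
  proof (rule ccontr)
    assume "f x \<noteq> 0"
    with x have "norm (F x) > 0"
      using box_subset_cbox[of a b] by (auto simp: F_def)
    from N(2)[OF x(2) this] obtain d where d: "d > 0" "\<And>h. 0 < h \<Longrightarrow> h < d \<Longrightarrow>
        norm (integral (cbox x (x + h *\<^sub>R One)) F /\<^sub>R h ^ DIM('a) - F x) < norm (F x)"
      by blast
    have "((\<lambda>h::real. x + h *\<^sub>R One) \<longlongrightarrow> x + 0 *\<^sub>R One) (at_right 0)"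
      by (intro tendsto_intros)
    then have "eventually (\<lambda>h. x + h *\<^sub>R One \<in> box a b) (at_right 0)"
      using x(1) by (intro topological_tendstoD) auto
    moreover have "eventually (\<lambda>h. h \<in> {0<..<d}) (at_right 0)"
      using d(1) by (rule eventually_at_right_real)
    ultimately have "eventually (\<lambda>h. x + h *\<^sub>R One \<in> box a b \<and> h \<in> {0<..<d}) (at_right 0)"
      by eventually_elim simp
    then obtain h where h: "x + h *\<^sub>R One \<in> box a b" "0 < h" "h < d"
      by (auto dest: eventually_happens)
    have "cbox x (x + h *\<^sub>R One) \<subseteq> cbox a b"
      using x(1) h(1) box_subset_cbox[of a b] by (auto simp: subset_box mem_box)
    from I0[OF this] d(2)[OF h(2,3)] show False by simp
  qed
  then have "{x \<in> cbox a b. f x \<noteq> 0} \<subseteq> N \<union> (cbox a b - box a b)"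
    by auto
  then show ?thesis
    using N(1) negligible_frontier_interval negligible_Un negligible_subset by blast
qed

text \<open>The fundamental lemma of the calculus of variations. Dominated convergence along the
  bumps turns orthogonality to test functions into vanishing integrals over boxes, and countably
  many closed boxes exhaust \<open>\<Omega>\<close>.\<close>

lemma locally_integrable_AE_zero:
  fixes w :: "real^'d \<Rightarrow> real"
  assumes "open \<Omega>" and w: "locally_integrable \<Omega> w"
    and zero: "\<And>\<phi>. test_function \<Omega> \<phi> \<Longrightarrow> (LINT x|lebesgue_on \<Omega>. w x * \<phi> x) = 0"
  shows "AE x in lebesgue_on \<Omega>. w x = 0"
proof -
  have \<Omega>: "\<Omega> \<in> sets lebesgue"
    using \<open>open \<Omega>\<close> by (rule sets_lebesgue_open)
  have box_zero: "(LINT x|lebesgue_on \<Omega>. w x * indicator (box c d) x) = 0" if "cbox c d \<subseteq> \<Omega>" for c d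
  proof -
    have "integrable (lebesgue_on (cbox c d)) w"
      using w that by (simp add: locally_integrable_def integrable_restrict_space set_integrable_def)
    then have "integrable (lebesgue_on (cbox c d)) (\<lambda>x. w x * indicator (cbox c d) x)"
      by (rule Bochner_Integration.integrable_cong[THEN iffD1, rotated 2]) auto
    \<comment> \<open>The dominating function lives on the closed box, because local integrability
      gives information on compact sets.\<close>
    then have dom: "integrable (lebesgue_on \<Omega>) (\<lambda>x. w x * indicator (cbox c d) x)"
      using that \<Omega> by (subst integrable_lebesgue_on_support[of \<Omega> "cbox c d"]) auto
    have bump: "test_function \<Omega> (box_bump c d n)" for n
      by (rule test_function_box_bump[OF that])
    have "(\<lambda>n. LINT x|lebesgue_on \<Omega>. w x * box_bump c d n x)
        \<longlonglongrightarrow> (LINT x|lebesgue_on \<Omega>. w x * indicator (box c d) x)"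
    proof (rule integral_dominated_convergence[where w = "\<lambda>x. norm (w x * indicator (cbox c d) x)"])
      \<comment> \<open>Measurability of \<open>w\<close> on all of \<open>\<Omega>\<close> has not
        been established; inserting the indicator of the closed box borrows it from
        \<open>dom\<close>.\<close>
      have "(\<lambda>x. w x * indicator (cbox c d) x * indicator (box c d) x) \<in> borel_measurable (lebesgue_on \<Omega>)"
        using that \<Omega> box_subset_cbox[of c d]
        by (intro borel_measurable_times borel_measurable_integrable[OF dom] borel_measurable_indicator)
          (auto simp: sets_restrict_space_iff)
      also have "(\<lambda>x. w x * indicator (cbox c d) x * indicator (box c d) x)
          = (\<lambda>x. w x * indicator (box c d) x)"
        using box_subset_cbox[of c d] by (auto simp: indicator_def fun_eq_iff)
      finally show "(\<lambda>x. w x * indicator (box c d) x) \<in> borel_measurable (lebesgue_on \<Omega>)" .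
      show "(\<lambda>x. w x * box_bump c d n x) \<in> borel_measurable (lebesgue_on \<Omega>)" for n
      proof (rule borel_measurable_integrable)
        obtain K where "compact K" "K \<subseteq> \<Omega>" "\<And>x. x \<notin> K \<Longrightarrow> box_bump c d n x = 0"
          using test_function_support[OF bump] by metis
        then show "integrable (lebesgue_on \<Omega>) (\<lambda>x. w x * box_bump c d n x)"
          using locally_integrable_mult_integrable[OF \<open>open \<Omega>\<close> w] test_function_smooth(1)[OF bump] by blast
      qed
      show "AE x in lebesgue_on \<Omega>. (\<lambda>n. w x * box_bump c d n x) \<longlonglongrightarrow> w x * indicator (box c d) x"
        by (intro AE_I2 tendsto_intros box_bump_tendsto)
      show "AE x in lebesgue_on \<Omega>. norm (w x * box_bump c d n x) \<le> norm (w x * indicator (cbox c d) x)" for n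
      proof (rule AE_I2)
        fix x
        have "\<bar>box_bump c d n x\<bar> \<le> indicator (cbox c d) x"
          using box_bump_bounds[of c d n x] box_bump_eq_0[of x c d n] box_subset_cbox[of c d]
          by (auto simp: indicator_def)
        then show "norm (w x * box_bump c d n x) \<le> norm (w x * indicator (cbox c d) x)"
          by (simp add: abs_mult mult_left_mono)
      qed
    qed (use dom in simp)
    then show ?thesis
      using zero[OF bump] by (simp add: LIMSEQ_const_iff)
  qed
  obtain \<D> where \<D>: "countable \<D>" "\<D> \<subseteq> Pow \<Omega>" "\<And>X. X \<in> \<D> \<Longrightarrow> \<exists>a b. X = cbox a b" "\<Union>\<D> = \<Omega>"
    using open_countable_Union_open_cbox[OF \<open>open \<Omega>\<close>] by metis
  have "negligible {x \<in> X. w x \<noteq> 0}" if X: "X \<in> \<D>" for X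
  proof -
    obtain a b where "X = cbox a b" "X \<subseteq> \<Omega>"
      using \<D> X by blast
    then show ?thesis
      using w box_zero \<Omega>
      by (auto intro!: negligible_if_integral_box_zero[where f = w and \<Omega> = \<Omega>] simp: locally_integrable_def)
  qed
  then have "negligible (\<Union>X\<in>\<D>. {x \<in> X. w x \<noteq> 0})"
    using \<D>(1) by (intro negligible_countable_Union) auto
  also have "(\<Union>X\<in>\<D>. {x \<in> X. w x \<noteq> 0}) = {x \<in> \<Omega>. w x \<noteq> 0}"
    using \<D>(4) by blast
  finally have "{x \<in> \<Omega>. w x \<noteq> 0} \<in> null_sets lebesgue"
    by (simp add: negligible_iff_null_sets)
  then have "AE x in lebesgue. x \<notin> {x \<in> \<Omega>. w x \<noteq> 0}"
    by (rule AE_not_in)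
  then show ?thesis
    using \<Omega> by (subst AE_restrict_space_iff) auto
qed

text \<open>The difference of two weak gradients is a weak gradient of 0, so each of its components
  is orthogonal to all test functions.\<close>

lemma has_weak_gradient_unique:
  assumes "open \<Omega>" "has_weak_gradient \<Omega> v g" "has_weak_gradient \<Omega> v h"
  shows "AE x in lebesgue_on \<Omega>. g x = h x"
proof -
  have 0: "has_weak_gradient \<Omega> (\<lambda>x. 0) (\<lambda>x. g x - h x)"
    using has_weak_gradient_diff[OF assms] by simp
  have "AE x in lebesgue_on \<Omega>. (g x - h x) $ i = 0" for i
  proof (rule locally_integrable_AE_zero[OF \<open>open \<Omega>\<close>])
    show "locally_integrable \<Omega> (\<lambda>x. (g x - h x) $ i)"
      using 0 by (intro locally_integrable_component) (simp add: has_weak_gradient_def)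
    show "(LINT x|lebesgue_on \<Omega>. (g x - h x) $ i * \<phi> x) = 0" if "test_function \<Omega> \<phi>" for \<phi>
    proof -
      have "(LINT x|lebesgue_on \<Omega>. 0 * partial_deriv i \<phi> x)
          = - (LINT x|lebesgue_on \<Omega>. (g x - h x) $ i * \<phi> x)"
        using 0 that unfolding has_weak_gradient_def by blast
      then show ?thesis by simp
    qed
  qed
  then have "AE x in lebesgue_on \<Omega>. \<forall>i\<in>UNIV. (g x - h x) $ i = 0"
    by (intro AE_finite_allI) auto
  then show ?thesis
    by eventually_elim (simp add: vec_eq_iff)
qed

lemma has_weak_gradient_weak_grad:
  "has_weak_gradient \<Omega> v g \<Longrightarrow> has_weak_gradient \<Omega> v (weak_grad \<Omega> v)"
  unfolding weak_grad_def by (rule someI[where P = "has_weak_gradient \<Omega> v"])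

text \<open>Lets any explicitly known weak gradient stand in for the representative picked by
  \<open>SOME\<close>.\<close>

lemma weak_grad_AE_eq:
  "open \<Omega> \<Longrightarrow> has_weak_gradient \<Omega> v g \<Longrightarrow> AE x in lebesgue_on \<Omega>. weak_grad \<Omega> v x = g x"
  by (blast intro: has_weak_gradient_unique has_weak_gradient_weak_grad)

text \<open>By translation invariance the difference quotients of \<open>F\<close> have integral 0; they converge
  dominatedly to the partial derivative.\<close>

lemma integral_partial_deriv_eq_0:
  fixes F :: "real^'d \<Rightarrow> real"
  assumes diff: "\<And>x. F differentiable at x" and cont: "continuous_on UNIV (partial_deriv i F)"
    and "compact K" and supp: "\<And>x. x \<notin> K \<Longrightarrow> F x = 0"
  shows "(LINT x|lborel. partial_deriv i F x) = 0"
proof -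
  define e where "e = (axis i 1 :: real^'d)"
  define s where "s n x = real (Suc n) * (F (inverse (real (Suc n)) *\<^sub>R e + x) - F x)" for n x
  have contF: "continuous_on UNIV F"
    using diff by (auto simp: continuous_on_eq_continuous_at intro: differentiable_imp_continuous_within)
  have der: "((\<lambda>t. F (t *\<^sub>R e + x)) has_real_derivative partial_deriv i F (t *\<^sub>R e + x)) (at t)" for x t
  proof -
    have "((\<lambda>t. t *\<^sub>R e + x) has_derivative (\<lambda>h. h *\<^sub>R e)) (at t)"
      by (auto intro!: derivative_eq_intros)
    from has_derivative_compose[OF this diff[unfolded frechet_derivative_works]]
    have *: "((\<lambda>t. F (t *\<^sub>R e + x)) has_derivative
        (\<lambda>h. frechet_derivative F (at (t *\<^sub>R e + x)) (h *\<^sub>R e))) (at t)" .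
    have "linear (frechet_derivative F (at (t *\<^sub>R e + x)))"
      using diff by (rule linear_frechet_derivative)
    then have "frechet_derivative F (at (t *\<^sub>R e + x)) (h *\<^sub>R e) = partial_deriv i F (t *\<^sub>R e + x) * h" for h
      by (simp add: linear_cmul partial_deriv_def e_def)
    with * show ?thesis
      by (simp add: has_field_derivative_def)
  qed
  obtain R where R: "K \<subseteq> cball 0 R"
    using compact_imp_bounded[OF \<open>compact K\<close>] by (auto simp: bounded_iff subset_eq)
  \<comment> \<open>Shifts have length at most 1: a point outside \<open>K'\<close> stays outside
    \<open>K\<close>, and a point of \<open>K'\<close> stays in the ball of radius
    \<open>R + 2\<close>, on which the derivative is bounded by \<open>B\<close>.\<close>
  define K' where "K' = cball (0 :: real^'d) (R + 1)"
  have out: "F (t *\<^sub>R e + x) = 0" if "x \<notin> K'" "0 \<le> t" "t \<le> 1" for x t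
  proof (rule supp)
    have "norm (t *\<^sub>R e) \<le> 1"
      using that by (simp add: e_def norm_axis_1)
    moreover have "norm x \<le> norm (t *\<^sub>R e + x) + norm (t *\<^sub>R e)"
      using norm_triangle_ineq4[of "t *\<^sub>R e + x" "t *\<^sub>R e"] by simp
    ultimately show "t *\<^sub>R e + x \<notin> K"
      using R that by (force simp: K'_def)
  qed
  have "compact (cball (0 :: real^'d) (R + 2))"
    by simp
  then have "bounded (partial_deriv i F ` cball 0 (R + 2))"
    using cont by (intro compact_imp_bounded compact_continuous_image) (auto intro: continuous_on_subset)
  then obtain B where "\<forall>y\<in>partial_deriv i F ` cball 0 (R + 2). norm y \<le> B"
    unfolding bounded_iff by blast
  then have B: "\<bar>partial_deriv i F x\<bar> \<le> B" if "norm x \<le> R + 2" for x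
    using that by simp
  have int: "integrable lborel F"
  proof -
    have "integrable lborel (\<lambda>x. indicator K x *\<^sub>R F x)"
      using \<open>compact K\<close> contF by (intro borel_integrable_compact) (auto intro: continuous_on_subset)
    also have "(\<lambda>x. indicator K x *\<^sub>R F x) = F"
      using supp by (auto simp: indicator_def fun_eq_iff)
    finally show ?thesis .
  qed
  have Fm: "F \<in> borel_measurable borel"
    using contF by (rule borel_measurable_continuous_onI)
  have "(\<lambda>n. LINT x|lborel. s n x) \<longlonglongrightarrow> (LINT x|lborel. partial_deriv i F x)"
  proof (rule integral_dominated_convergence[where w = "\<lambda>x. B * indicator K' x"])
    show "partial_deriv i F \<in> borel_measurable lborel"
      using cont by (simp add: borel_measurable_continuous_onI)
    show "s n \<in> borel_measurable lborel" for n
      using Fm unfolding s_def by measurable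
    show "integrable lborel (\<lambda>x. B * indicator K' x)"
      unfolding K'_def by (intro integrable_mult_right integrable_real_indicator) (use emeasure_bounded_finite[OF bounded_cball] in auto)
    show "AE x in lborel. (\<lambda>n. s n x) \<longlonglongrightarrow> partial_deriv i F x"
    proof (rule AE_I2)
      fix x
      have "((\<lambda>h. (F ((0 + h) *\<^sub>R e + x) - F (0 *\<^sub>R e + x)) / h) \<longlongrightarrow> partial_deriv i F (0 *\<^sub>R e + x)) (at 0)"
        using der[of x 0] by (simp only: DERIV_def)
      moreover have "filterlim (\<lambda>n. inverse (real (Suc n))) (at 0) sequentially"
        using LIMSEQ_inverse_real_of_nat by (auto simp: filterlim_at)
      ultimately have "(\<lambda>n. (F ((0 + inverse (real (Suc n))) *\<^sub>R e + x) - F (0 *\<^sub>R e + x)) / inverse (real (Suc n)))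
          \<longlonglongrightarrow> partial_deriv i F (0 *\<^sub>R e + x)"
        by (rule filterlim_compose)
      then show "(\<lambda>n. s n x) \<longlonglongrightarrow> partial_deriv i F x"
        by (simp add: s_def divide_inverse mult.commute del: of_nat_Suc)
    qed
    show "AE x in lborel. norm (s n x) \<le> B * indicator K' x" for n
    proof (rule AE_I2)
      fix x
      define h where "h = inverse (real (Suc n))"
      have h: "0 < h" "h \<le> 1" "real (Suc n) = 1 / h"
        by (auto simp: h_def field_simps)
      show "norm (s n x) \<le> B * indicator K' x"
      proof (cases "x \<in> K'")
        case True
        \<comment> \<open>The mean value theorem along the segment turns the quotient into a value
          of the derivative, which gives a bound uniform in \<open>n\<close>.\<close>
        obtain t where t: "0 < t" "t < h"
          "F (h *\<^sub>R e + x) - F (0 *\<^sub>R e + x) = (h - 0) * partial_deriv i F (t *\<^sub>R e + x)"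
          using MVT2[OF h(1), of "\<lambda>t. F (t *\<^sub>R e + x)" "\<lambda>t. partial_deriv i F (t *\<^sub>R e + x)"] der by blast
        have "norm (t *\<^sub>R e + x) \<le> t + norm x"
          using t norm_triangle_ineq[of "t *\<^sub>R e" x] by (simp add: e_def norm_axis_1)
        then have "\<bar>partial_deriv i F (t *\<^sub>R e + x)\<bar> \<le> B"
          using True t h by (intro B) (auto simp: K'_def)
        moreover have "s n x = partial_deriv i F (t *\<^sub>R e + x)"
          using t(3) h(1) unfolding s_def h_def[symmetric] by (simp add: h(3) del: of_nat_Suc)
        ultimately show ?thesis using True by simp
      next
        case False
        then show ?thesis
          using out[OF False, of h] out[OF False, of 0] h by (simp add: s_def h_def)
      qed
    qed
  qed
  moreover have "(LINT x|lborel. s n x) = 0" for n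
  proof -
    define c where "c = inverse (real (Suc n)) *\<^sub>R e"
    have "integrable (distr lborel borel ((+) c)) F"
      using int by (simp add: lborel_distr_plus)
    then have "integrable lborel (\<lambda>x. F (c + x))"
      by (rule integrable_distr[rotated]) simp
    moreover have "(LINT x|lborel. F (c + x)) = (LINT x|distr lborel borel ((+) c). F x)"
      using Fm by (simp add: integral_distr)
    ultimately show ?thesis
      using int by (simp add: s_def c_def[symmetric] lborel_distr_plus del: of_nat_Suc)
  qed
  ultimately show ?thesis
    by (simp add: LIMSEQ_const_iff)
qed

section \<open>Sobolev functions\<close>

text \<open>Integration by parts without boundary term: the product
  \<open>\<phi> x * \<psi> x\<close> has compact support in \<open>\<Omega>\<close>, so its partial
  derivative integrates to zero over the whole space, and the product rule splits that
  integral.\<close>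

lemma test_function_has_weak_gradient:
  assumes "open \<Omega>" and t: "test_function \<Omega> \<phi>"
  shows "has_weak_gradient \<Omega> \<phi> (\<lambda>x. \<chi> i. partial_deriv i \<phi> x)"
  unfolding has_weak_gradient_def
proof (intro conjI allI impI)
  show "locally_integrable \<Omega> \<phi>" "locally_integrable \<Omega> (\<lambda>x. \<chi> i. partial_deriv i \<phi> x)"
    using test_function_smooth[OF t]
    by (auto intro!: continuous_locally_integrable continuous_on_vec_lambda)
  fix \<psi> i assume s: "test_function \<Omega> \<psi>"
  obtain K where K: "compact K" "K \<subseteq> \<Omega>" "\<And>x. x \<notin> K \<Longrightarrow> \<psi> x = 0"
    "\<And>x i. x \<notin> K \<Longrightarrow> partial_deriv i \<psi> x = 0"
    using test_function_support[OF s] by metis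
  note t' = test_function_smooth[OF t] and s' = test_function_smooth[OF s]
  let ?F = "\<lambda>x. \<phi> x * \<psi> x"
  let ?G = "\<lambda>x. \<phi> x * partial_deriv i \<psi> x + partial_deriv i \<phi> x * \<psi> x"
  have F: "partial_deriv i ?F = ?G"
    using t'(2) s'(2) by (auto simp: partial_deriv_mult)
  have G: "continuous_on UNIV ?G"
    using t' s' by (intro continuous_intros)
  have "(LINT x|lborel. partial_deriv i ?F x) = 0"
    using K t' s' by (intro integral_partial_deriv_eq_0[of _ _ K]) (auto simp: F G)
  then have "(LINT x|lborel. ?G x) = 0"
    by (simp add: F)
  then have "(LINT x|lebesgue. ?G x) = 0"
    using G by (subst integral_completion) (auto intro: borel_measurable_continuous_onI)
  moreover have "?G x = 0" if "x \<notin> \<Omega>" for x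
  proof -
    have "x \<notin> K"
      using that K(2) by blast
    then show ?thesis
      by (simp add: K(3,4))
  qed
  then have "(\<lambda>x. indicator \<Omega> x *\<^sub>R ?G x) = ?G"
    by (auto simp: indicator_def fun_eq_iff)
  ultimately have "(LINT x|lebesgue_on \<Omega>. ?G x) = 0"
    using \<open>open \<Omega>\<close> by (simp add: integral_restrict_space sets_lebesgue_open)
  moreover have "integrable (lebesgue_on \<Omega>) (\<lambda>x. \<phi> x * partial_deriv i \<psi> x)"
    "integrable (lebesgue_on \<Omega>) (\<lambda>x. partial_deriv i \<phi> x * \<psi> x)"
    using K t' s' \<open>open \<Omega>\<close>
    by (auto intro!: locally_integrable_mult_integrable[where K = K] continuous_locally_integrable)
  ultimately show "(LINT x|lebesgue_on \<Omega>. \<phi> x * partial_deriv i \<psi> x)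
      = - (LINT x|lebesgue_on \<Omega>. (\<chi> i. partial_deriv i \<phi> x) $ i * \<psi> x)"
    by simp
qed

lemma L2_continuous_compact_support:
  fixes f :: "real^'d \<Rightarrow> 'b::euclidean_space"
  assumes "open \<Omega>" "continuous_on UNIV f" "compact K" "K \<subseteq> \<Omega>" "\<And>x. x \<notin> K \<Longrightarrow> f x = 0"
  shows "f \<in> L2 \<Omega>"
proof -
  have K: "K \<in> sets lebesgue"
    using \<open>compact K\<close> by (simp add: borel_compact sets_completionI_sets)
  have "f \<in> borel_measurable (lebesgue_on \<Omega>)"
    using assms by (intro continuous_imp_measurable_on_sets_lebesgue sets_lebesgue_open)
      (auto intro: continuous_on_subset)
  moreover have "locally_integrable \<Omega> (\<lambda>x. (norm (f x))\<^sup>2)"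
    using assms by (intro continuous_locally_integrable continuous_intros)
  then have "integrable (lebesgue_on K) (\<lambda>x. (norm (f x))\<^sup>2)"
    using assms K by (auto simp: locally_integrable_def integrable_restrict_space set_integrable_def)
  then have "integrable (lebesgue_on \<Omega>) (\<lambda>x. (norm (f x))\<^sup>2)"
    using assms K by (subst integrable_lebesgue_on_support[of \<Omega> K]) (auto simp: sets_lebesgue_open)
  ultimately show ?thesis
    by (simp add: L2_def)
qed

section \<open>Square-integrable functions and \<open>H1\<close>\<close>

lemma L2_norm_sq: "(L2_norm \<Omega> f)\<^sup>2 = (LINT x|lebesgue_on \<Omega>. (norm (f x))\<^sup>2)"
  by (simp add: L2_norm_def)

lemma L2_norm_nonneg: "0 \<le> L2_norm \<Omega> f"
  by (simp add: L2_norm_def)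

text \<open>The parallelogram identity with the square of \<open>norm (a + b)\<close> dropped. It
  takes the place of the triangle inequality for the L2 and H1 norms; the factor 2 is harmless where
  only finiteness or convergence to zero matters.\<close>

lemma norm_diff_sq_le: "(norm (a - b))\<^sup>2 \<le> 2 * (norm a)\<^sup>2 + 2 * (norm b)\<^sup>2"
  for a b :: "'a::real_inner"
proof -
  have "0 \<le> (norm (a + b))\<^sup>2"
    by simp
  then show ?thesis
    by (simp add: power2_norm_eq_inner inner_simps inner_commute)
qed

lemma
  assumes f: "f \<in> L2 \<Omega>" and g: "g \<in> L2 \<Omega>"
  shows L2_diff: "(\<lambda>x. f x - g x) \<in> L2 \<Omega>"
    and L2_norm_diff_sq_le:
      "(L2_norm \<Omega> (\<lambda>x. f x - g x))\<^sup>2 \<le> 2 * (L2_norm \<Omega> f)\<^sup>2 + 2 * (L2_norm \<Omega> g)\<^sup>2"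
proof -
  have m: "(\<lambda>x. f x - g x) \<in> borel_measurable (lebesgue_on \<Omega>)"
    using f g by (auto simp: L2_def)
  have dom: "integrable (lebesgue_on \<Omega>) (\<lambda>x. 2 * (norm (f x))\<^sup>2 + 2 * (norm (g x))\<^sup>2)"
    using f g by (auto simp: L2_def)
  then have int: "integrable (lebesgue_on \<Omega>) (\<lambda>x. (norm (f x - g x))\<^sup>2)"
    by (rule Bochner_Integration.integrable_bound) (use m norm_diff_sq_le in auto)
  show "(\<lambda>x. f x - g x) \<in> L2 \<Omega>"
    using m int by (simp add: L2_def)
  have "(LINT x|lebesgue_on \<Omega>. (norm (f x - g x))\<^sup>2)
      \<le> (LINT x|lebesgue_on \<Omega>. 2 * (norm (f x))\<^sup>2 + 2 * (norm (g x))\<^sup>2)"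
    using int dom norm_diff_sq_le by (rule integral_mono)
  also have "\<dots> = 2 * (LINT x|lebesgue_on \<Omega>. (norm (f x))\<^sup>2) + 2 * (LINT x|lebesgue_on \<Omega>. (norm (g x))\<^sup>2)"
    using f g by (simp add: L2_def)
  finally show "(L2_norm \<Omega> (\<lambda>x. f x - g x))\<^sup>2 \<le> 2 * (L2_norm \<Omega> f)\<^sup>2 + 2 * (L2_norm \<Omega> g)\<^sup>2"
    by (simp add: L2_norm_sq)
qed

text \<open>Rests on the completeness of Lebesgue measure, applied to the extensions by zero: a
  change on a null set preserves measurability.\<close>

lemma borel_measurable_lebesgue_on_AE:
  fixes f g :: "'a::euclidean_space \<Rightarrow> 'b::euclidean_space"
  assumes "\<Omega> \<in> sets lebesgue" "f \<in> borel_measurable (lebesgue_on \<Omega>)" "AE x in lebesgue_on \<Omega>. f x = g x"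
  shows "g \<in> borel_measurable (lebesgue_on \<Omega>)"
proof -
  have "AE x in lebesgue. x \<in> \<Omega> \<longrightarrow> f x = g x"
    using assms(1,3) by (simp add: AE_restrict_space_iff)
  then have "AE x in lebesgue. indicator \<Omega> x *\<^sub>R f x = indicator \<Omega> x *\<^sub>R g x"
    by (rule AE_mp) (auto simp: indicator_def)
  moreover have "(\<lambda>x. indicator \<Omega> x *\<^sub>R f x) \<in> borel_measurable lebesgue"
    using assms by (simp add: borel_measurable_restrict_space_iff)
  ultimately have "(\<lambda>x. indicator \<Omega> x *\<^sub>R g x) \<in> borel_measurable lebesgue"
    by (rule borel_measurable_AE[rotated])
  then show ?thesis
    using assms by (simp add: borel_measurable_restrict_space_iff)
qed

lemma
  assumes "open \<Omega>" and f: "f \<in> L2 \<Omega>" and eq: "AE x in lebesgue_on \<Omega>. f x = g x"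
  shows L2_AE_cong: "g \<in> L2 \<Omega>"
    and L2_norm_AE_cong: "L2_norm \<Omega> f = L2_norm \<Omega> g"
proof -
  have m: "f \<in> borel_measurable (lebesgue_on \<Omega>)"
    using f by (simp add: L2_def)
  then have m': "g \<in> borel_measurable (lebesgue_on \<Omega>)"
    using borel_measurable_lebesgue_on_AE[OF sets_lebesgue_open[OF \<open>open \<Omega>\<close>] m eq] by simp
  have ae: "AE x in lebesgue_on \<Omega>. (norm (f x))\<^sup>2 = (norm (g x))\<^sup>2"
    using eq by eventually_elim simp
  have "integrable (lebesgue_on \<Omega>) (\<lambda>x. (norm (g x))\<^sup>2)"
  proof (rule integrable_cong_AE_imp[OF _ _ ae])
    show "integrable (lebesgue_on \<Omega>) (\<lambda>x. (norm (f x))\<^sup>2)"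
      using f by (simp add: L2_def)
    show "(\<lambda>x. (norm (g x))\<^sup>2) \<in> borel_measurable (lebesgue_on \<Omega>)"
      using m' by measurable
  qed
  then show "g \<in> L2 \<Omega>"
    using m' by (simp add: L2_def)
  have "(LINT x|lebesgue_on \<Omega>. (norm (f x))\<^sup>2) = (LINT x|lebesgue_on \<Omega>. (norm (g x))\<^sup>2)"
    by (rule integral_cong_AE[OF _ _ ae]) (use m m' in measurable)
  then show "L2_norm \<Omega> f = L2_norm \<Omega> g"
    by (simp add: L2_norm_def)
qed

text \<open>Membership in \<open>H1\<close> promises some weak gradient in \<open>L2\<close>, while
  \<open>SOME\<close> may pick another one; uniqueness almost everywhere carries
  square-integrability over.\<close>

lemma
  assumes "open \<Omega>" "v \<in> H1 \<Omega>"
  shows H1_weak_grad: "has_weak_gradient \<Omega> v (weak_grad \<Omega> v)"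
    and H1_weak_grad_L2: "weak_grad \<Omega> v \<in> L2 \<Omega>"
proof -
  obtain g where g: "g \<in> L2 \<Omega>" "has_weak_gradient \<Omega> v g"
    using assms by (auto simp: H1_def)
  show *: "has_weak_gradient \<Omega> v (weak_grad \<Omega> v)"
    by (rule has_weak_gradient_weak_grad[OF g(2)])
  show "weak_grad \<Omega> v \<in> L2 \<Omega>"
    by (rule L2_AE_cong[OF assms(1) g(1) has_weak_gradient_unique[OF assms(1) g(2) *]])
qed

lemma
  assumes "open \<Omega>" and v: "v \<in> H1 \<Omega>" and w: "w \<in> H1 \<Omega>"
  shows H1_diff: "(\<lambda>x. v x - w x) \<in> H1 \<Omega>"
    and weak_grad_diff:
      "AE x in lebesgue_on \<Omega>. weak_grad \<Omega> (\<lambda>x. v x - w x) x = weak_grad \<Omega> v x - weak_grad \<Omega> w x"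
proof -
  have d: "has_weak_gradient \<Omega> (\<lambda>x. v x - w x) (\<lambda>x. weak_grad \<Omega> v x - weak_grad \<Omega> w x)"
    using assms by (intro has_weak_gradient_diff H1_weak_grad)
  moreover have "(\<lambda>x. weak_grad \<Omega> v x - weak_grad \<Omega> w x) \<in> L2 \<Omega>"
    using assms by (intro L2_diff H1_weak_grad_L2)
  moreover have "(\<lambda>x. v x - w x) \<in> L2 \<Omega>"
    using v w by (intro L2_diff) (auto simp: H1_def)
  ultimately show "(\<lambda>x. v x - w x) \<in> H1 \<Omega>"
    unfolding H1_def by blast
  show "AE x in lebesgue_on \<Omega>. weak_grad \<Omega> (\<lambda>x. v x - w x) x = weak_grad \<Omega> v x - weak_grad \<Omega> w x"
    by (rule weak_grad_AE_eq[OF assms(1) d])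
qed

lemma test_function_H1:
  assumes "open \<Omega>" "test_function \<Omega> \<phi>"
  shows "\<phi> \<in> H1 \<Omega>"
proof -
  obtain K where K: "compact K" "K \<subseteq> \<Omega>" "\<And>x. x \<notin> K \<Longrightarrow> \<phi> x = 0"
    "\<And>x i. x \<notin> K \<Longrightarrow> partial_deriv i \<phi> x = 0"
    using test_function_support[OF assms(2)] by metis
  note s = test_function_smooth[OF assms(2)]
  have "\<phi> \<in> L2 \<Omega>"
    using K s by (intro L2_continuous_compact_support[OF assms(1)]) auto
  moreover have "(\<lambda>x. \<chi> i. partial_deriv i \<phi> x) \<in> L2 \<Omega>"
    using K s by (intro L2_continuous_compact_support[OF assms(1), where K = K])
      (auto simp: vec_eq_iff intro!: continuous_on_vec_lambda)
  ultimately show ?thesis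
    using test_function_has_weak_gradient[OF assms] by (auto simp: H1_def)
qed

lemma H1_norm_diff_sq_le:
  assumes "open \<Omega>" "v \<in> H1 \<Omega>" "w \<in> H1 \<Omega>"
  shows "(H1_norm \<Omega> (\<lambda>x. v x - w x))\<^sup>2 \<le> 2 * (H1_norm \<Omega> v)\<^sup>2 + 2 * (H1_norm \<Omega> w)\<^sup>2"
proof -
  have "L2_norm \<Omega> (weak_grad \<Omega> (\<lambda>x. v x - w x)) = L2_norm \<Omega> (\<lambda>x. weak_grad \<Omega> v x - weak_grad \<Omega> w x)"
    using assms by (intro L2_norm_AE_cong H1_weak_grad_L2 H1_diff weak_grad_diff)
  moreover have "(L2_norm \<Omega> (\<lambda>x. weak_grad \<Omega> v x - weak_grad \<Omega> w x))\<^sup>2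
      \<le> 2 * (L2_norm \<Omega> (weak_grad \<Omega> v))\<^sup>2 + 2 * (L2_norm \<Omega> (weak_grad \<Omega> w))\<^sup>2"
    using assms by (intro L2_norm_diff_sq_le H1_weak_grad_L2)
  moreover have "(L2_norm \<Omega> (\<lambda>x. v x - w x))\<^sup>2 \<le> 2 * (L2_norm \<Omega> v)\<^sup>2 + 2 * (L2_norm \<Omega> w)\<^sup>2"
    using assms by (intro L2_norm_diff_sq_le) (auto simp: H1_def)
  ultimately show ?thesis
    by (simp add: H1_norm_def)
qed

text \<open>The functions \<open>\<phi> n x - \<psi> n x\<close> approximate the difference:
  regrouping splits their error into the two given errors, and the estimate of the squares forces it
  to zero.\<close>

lemma H10_diff:
  assumes "open \<Omega>" "v \<in> H10 \<Omega>" "w \<in> H10 \<Omega>"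
  shows "(\<lambda>x. v x - w x) \<in> H10 \<Omega>"
proof -
  obtain \<phi> where \<phi>: "\<forall>n. test_function \<Omega> (\<phi> n)" "(\<lambda>n. H1_norm \<Omega> (\<lambda>x. v x - \<phi> n x)) \<longlonglongrightarrow> 0"
    using assms(2) unfolding H10_def mem_Collect_eq by (elim conjE exE)
  obtain \<psi> where \<psi>: "\<forall>n. test_function \<Omega> (\<psi> n)" "(\<lambda>n. H1_norm \<Omega> (\<lambda>x. w x - \<psi> n x)) \<longlonglongrightarrow> 0"
    using assms(3) unfolding H10_def mem_Collect_eq by (elim conjE exE)
  have v: "v \<in> H1 \<Omega>" and w: "w \<in> H1 \<Omega>"
    using assms by (auto simp: H10_def)
  let ?e = "\<lambda>n. H1_norm \<Omega> (\<lambda>x. (v x - w x) - (\<phi> n x - \<psi> n x))"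
  have lim: "(\<lambda>n. 2 * (H1_norm \<Omega> (\<lambda>x. v x - \<phi> n x))\<^sup>2 + 2 * (H1_norm \<Omega> (\<lambda>x. w x - \<psi> n x))\<^sup>2)
      \<longlonglongrightarrow> 2 * 0\<^sup>2 + 2 * 0\<^sup>2"
    by (intro tendsto_intros \<phi> \<psi>)
  have "(?e n)\<^sup>2 \<le> 2 * (H1_norm \<Omega> (\<lambda>x. v x - \<phi> n x))\<^sup>2 + 2 * (H1_norm \<Omega> (\<lambda>x. w x - \<psi> n x))\<^sup>2" for n
  proof -
    have "(\<lambda>x. (v x - w x) - (\<phi> n x - \<psi> n x)) = (\<lambda>x. (v x - \<phi> n x) - (w x - \<psi> n x))"
      by (simp add: fun_eq_iff)
    then show ?thesis
      using H1_norm_diff_sq_le[OF \<open>open \<Omega>\<close> H1_diff[OF \<open>open \<Omega>\<close> v test_function_H1[OF \<open>open \<Omega>\<close> \<phi>(1)[rule_format]]]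
          H1_diff[OF \<open>open \<Omega>\<close> w test_function_H1[OF \<open>open \<Omega>\<close> \<psi>(1)[rule_format]]]] by simp
  qed
  then have "\<forall>\<^sub>F n in sequentially. norm ((?e n)\<^sup>2) \<le>
      2 * (H1_norm \<Omega> (\<lambda>x. v x - \<phi> n x))\<^sup>2 + 2 * (H1_norm \<Omega> (\<lambda>x. w x - \<psi> n x))\<^sup>2"
    by (intro always_eventually) simp
  then have "(\<lambda>n. (?e n)\<^sup>2) \<longlonglongrightarrow> 0"
    by (rule Lim_null_comparison) (use lim in simp)
  then have "?e \<longlonglongrightarrow> 0"
    by simp
  moreover have "\<forall>n. test_function \<Omega> (\<lambda>x. \<phi> n x - \<psi> n x)"
    using \<phi>(1) \<psi>(1) by (auto intro: test_function_diff)
  ultimately show ?thesis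
    unfolding H10_def using H1_diff[OF \<open>open \<Omega>\<close> v w]
    by (auto intro!: exI[of _ "\<lambda>n x. \<phi> n x - \<psi> n x"])
qed

section \<open>Finite element functions\<close>

lemma polynomials_diff:
  assumes "p \<in> polynomials k" "q \<in> polynomials k"
  shows "(\<lambda>x. p x - q x) \<in> polynomials k"
proof -
  obtain c d where "\<forall>x. p x = (\<Sum>\<alpha> | (\<Sum>i\<in>UNIV. \<alpha> i) \<le> k. c \<alpha> * (\<Prod>i\<in>UNIV. (x $ i) ^ \<alpha> i))"
    "\<forall>x. q x = (\<Sum>\<alpha> | (\<Sum>i\<in>UNIV. \<alpha> i) \<le> k. d \<alpha> * (\<Prod>i\<in>UNIV. (x $ i) ^ \<alpha> i))"
    using assms unfolding polynomials_def by blast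
  then show ?thesis
    unfolding polynomials_def
    by (auto intro!: exI[of _ "\<lambda>\<alpha>. c \<alpha> - d \<alpha>"] simp: left_diff_distrib sum_subtractf)
qed

lemma fe_space_diff:
  assumes "open \<Omega>" "v \<in> fe_space \<Omega> \<T> k" "w \<in> fe_space \<Omega> \<T> k"
  shows "(\<lambda>x. v x - w x) \<in> fe_space \<Omega> \<T> k"
proof -
  have "\<exists>r\<in>polynomials k. AE x in lebesgue_on T. v x - w x = r x" if "T \<in> \<T>" for T
  proof -
    have "\<exists>p\<in>polynomials k. AE x in lebesgue_on T. v x = p x"
      using assms(2) that by (simp add: fe_space_def)
    then obtain p where p: "p \<in> polynomials k" "AE x in lebesgue_on T. v x = p x"
      by (rule bexE)
    have "\<exists>q\<in>polynomials k. AE x in lebesgue_on T. w x = q x"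
      using assms(3) that by (simp add: fe_space_def)
    then obtain q where q: "q \<in> polynomials k" "AE x in lebesgue_on T. w x = q x"
      by (rule bexE)
    have "AE x in lebesgue_on T. v x - w x = p x - q x"
      using p(2) q(2) by eventually_elim simp
    then show ?thesis
      using polynomials_diff[OF p(1) q(1)] by (intro bexI[of _ "\<lambda>x. p x - q x"])
  qed
  then show ?thesis
    using assms H10_diff[of \<Omega> v w] by (auto simp: fe_space_def)
qed

section \<open>The energy form and quasi-optimality\<close>

text \<open>Expands the nonnegative quadratic form at \<open>x - t *\<^sub>R y\<close>; symmetry
  merges the two mixed terms. The parameter stays free for two purposes: \<open>t\<close> = 1 and -1
  give integrability of the mixed term, and a choice of \<open>t\<close> after integration gives
  Cauchy-Schwarz.\<close>

lemma symmetric_matrix_AM_GM: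
  fixes A :: "real^'d^'d"
  assumes "transpose A = A" and nonneg: "\<And>\<xi>. 0 \<le> \<xi> \<bullet> (A *v \<xi>)"
  shows "2 * t * ((A *v x) \<bullet> y) \<le> (A *v x) \<bullet> x + t\<^sup>2 * ((A *v y) \<bullet> y)"
proof -
  have c: "(A *v x) \<bullet> y = (A *v y) \<bullet> x"
    by (metis assms(1) dot_lmul_matrix inner_commute transpose_matrix_vector)
  have "0 \<le> (x - t *\<^sub>R y) \<bullet> (A *v (x - t *\<^sub>R y))"
    by (rule nonneg)
  also have "\<dots> = (A *v x) \<bullet> x - 2 * t * ((A *v x) \<bullet> y) + t\<^sup>2 * ((A *v y) \<bullet> y)"
    using c
    by (simp add: matrix_vector_mult_diff_distrib matrix_vector_mult_scaleR inner_simps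
        inner_commute[of _ "A *v _"] power2_eq_square algebra_simps)
  finally show ?thesis
    by simp
qed

text \<open>The discriminant argument. For positive \<open>c\<close> the optimal parameter is
  \<open>t = b / c\<close>; for \<open>c = 0\<close> the bound is linear in \<open>t\<close> and
  forces \<open>b\<close> to be nonpositive.\<close>

lemma Cauchy_Schwarz_from_AM_GM:
  fixes a b c :: real
  assumes le: "\<And>t. 2 * t * b \<le> a + t\<^sup>2 * c" and "0 \<le> c"
  shows "b \<le> sqrt a * sqrt c"
proof (cases "c = 0")
  case True
  have "b \<le> 0"
  proof (rule ccontr)
    assume "\<not> b \<le> 0"
    \<comment> \<open>This parameter makes the left-hand side \<open>a + 1\<close>, which exceeds
      the right-hand side \<open>a\<close>.\<close>
    then have "2 * ((a + 1) / (2 * b)) * b = a + 1"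
      by simp
    with le[of "(a + 1) / (2 * b)"] True show False by simp
  qed
  with True show ?thesis by simp
next
  case False
  with \<open>0 \<le> c\<close> have "c > 0"
    by simp
  with le[of "b / c"] have "b\<^sup>2 \<le> a * c"
    by (simp add: power2_eq_square field_simps)
  then have "\<bar>b\<bar> \<le> sqrt (a * c)"
    by (metis real_sqrt_abs real_sqrt_le_iff)
  then show ?thesis
    by (simp add: real_sqrt_mult)
qed

text \<open>The energy form on vector fields. Here bilinearity follows directly from integrability,
  whereas differences inside \<open>energy_form\<close> require the chosen gradients to be replaced
  almost everywhere beforehand.\<close>

definition tensor_form ::
  "(real^'d) set \<Rightarrow> (real^'d \<Rightarrow> real^'d^'d) \<Rightarrow> (real^'d \<Rightarrow> real^'d) \<Rightarrow> (real^'d \<Rightarrow> real^'d) \<Rightarrow> real" where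
  "tensor_form \<Omega> D g h = (LINT x|lebesgue_on \<Omega>. (D x *v g x) \<bullet> h x)"

lemma energy_form_eq_tensor_form:
  "energy_form \<Omega> D v w = tensor_form \<Omega> D (weak_grad \<Omega> v) (weak_grad \<Omega> w)"
  by (simp add: energy_form_def tensor_form_def)

lemma diffusion_tensor_AE:
  assumes "diffusion_tensor \<Omega> D m M"
  shows "AE x in lebesgue_on \<Omega>. transpose (D x) = D x \<and>
    (\<forall>\<xi>. 0 \<le> \<xi> \<bullet> (D x *v \<xi>) \<and> m * (norm \<xi>)\<^sup>2 \<le> (D x *v \<xi>) \<bullet> \<xi> \<and> (D x *v \<xi>) \<bullet> \<xi> \<le> M * (norm \<xi>)\<^sup>2)"
proof -
  have "m > 0" "AE x in lebesgue_on \<Omega>. transpose (D x) = D x"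
    "AE x in lebesgue_on \<Omega>. \<forall>\<xi>. m * (norm \<xi>)\<^sup>2 \<le> \<xi> \<bullet> (D x *v \<xi>) \<and> \<xi> \<bullet> (D x *v \<xi>) \<le> M * (norm \<xi>)\<^sup>2"
    using assms by (auto simp: diffusion_tensor_def)
  from this(2,3) show ?thesis
  proof eventually_elim
    case (elim x)
    moreover have "0 \<le> \<xi> \<bullet> (D x *v \<xi>)" for \<xi>
      using elim(2) \<open>m > 0\<close> by (meson less_imp_le mult_nonneg_nonneg order_trans zero_le_power2)
    ultimately show ?case
      by (simp add: inner_commute)
  qed
qed

lemma borel_measurable_tensor_form:
  fixes D :: "real^'d \<Rightarrow> real^'d^'d"
  assumes "diffusion_tensor \<Omega> D m M" "g \<in> L2 \<Omega>" "h \<in> L2 \<Omega>"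
  shows "(\<lambda>x. (D x *v g x) \<bullet> h x) \<in> borel_measurable (lebesgue_on \<Omega>)"
proof -
  have D: "D \<in> borel_measurable (lebesgue_on \<Omega>)" and g: "g \<in> borel_measurable (lebesgue_on \<Omega>)"
    and h: "h \<in> borel_measurable (lebesgue_on \<Omega>)"
    using assms by (auto simp: diffusion_tensor_def L2_def)
  have "(\<lambda>A :: real^'d^'d. A $ i $ j) \<in> borel_measurable borel" "(\<lambda>y :: real^'d. y $ i) \<in> borel_measurable borel" for i j
    by (auto intro!: borel_measurable_continuous_onI continuous_intros)
  note nth = measurable_compose[OF D this(1)] measurable_compose[OF g this(2)] measurable_compose[OF h this(2)]
  show ?thesis
    unfolding matrix_vector_mult_def inner_vec_def vec_lambda_beta inner_real_def
    by (intro borel_measurable_sum borel_measurable_times nth)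
qed

text \<open>Both signs of the mixed term are dominated by the two quadratic terms, which are bounded
  by \<open>M\<close> times squared norms.\<close>

lemma integrable_tensor_form:
  assumes D: "diffusion_tensor \<Omega> D m M" and g: "g \<in> L2 \<Omega>" and h: "h \<in> L2 \<Omega>"
  shows "integrable (lebesgue_on \<Omega>) (\<lambda>x. (D x *v g x) \<bullet> h x)"
proof (rule Bochner_Integration.integrable_bound)
  show "integrable (lebesgue_on \<Omega>) (\<lambda>x. M * (norm (g x))\<^sup>2 + M * (norm (h x))\<^sup>2)"
    using g h by (auto simp: L2_def)
  show "AE x in lebesgue_on \<Omega>. norm ((D x *v g x) \<bullet> h x) \<le> norm (M * (norm (g x))\<^sup>2 + M * (norm (h x))\<^sup>2)"
    using diffusion_tensor_AE[OF D]
  proof eventually_elim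
    case (elim x)
    have "\<bar>2 * ((D x *v g x) \<bullet> h x)\<bar> \<le> (D x *v g x) \<bullet> g x + (D x *v h x) \<bullet> h x"
      using symmetric_matrix_AM_GM[of "D x" 1 "g x" "h x"] symmetric_matrix_AM_GM[of "D x" "-1" "g x" "h x"] elim
      by simp
    moreover have "(D x *v g x) \<bullet> g x \<le> M * (norm (g x))\<^sup>2" "(D x *v h x) \<bullet> h x \<le> M * (norm (h x))\<^sup>2"
      using elim by blast+
    ultimately show ?case by simp
  qed
qed (rule borel_measurable_tensor_form[OF assms])

lemma tensor_form_AE_cong:
  assumes D: "diffusion_tensor \<Omega> D m M" and L2: "g \<in> L2 \<Omega>" "g' \<in> L2 \<Omega>" "h \<in> L2 \<Omega>" "h' \<in> L2 \<Omega>"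
    and eq: "AE x in lebesgue_on \<Omega>. g x = g' x" "AE x in lebesgue_on \<Omega>. h x = h' x"
  shows "tensor_form \<Omega> D g h = tensor_form \<Omega> D g' h'"
proof -
  have "AE x in lebesgue_on \<Omega>. (D x *v g x) \<bullet> h x = (D x *v g' x) \<bullet> h' x"
    using eq by eventually_elim simp
  then show ?thesis
    unfolding tensor_form_def by (intro integral_cong_AE borel_measurable_tensor_form[OF D] L2)
qed

lemma tensor_form_diff_left:
  assumes "diffusion_tensor \<Omega> D m M" "g \<in> L2 \<Omega>" "g' \<in> L2 \<Omega>" "h \<in> L2 \<Omega>"
  shows "tensor_form \<Omega> D (\<lambda>x. g x - g' x) h = tensor_form \<Omega> D g h - tensor_form \<Omega> D g' h"
  using integrable_tensor_form[OF assms(1)] assms(2-)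
  by (simp add: tensor_form_def matrix_vector_mult_diff_distrib inner_diff_left)

lemma tensor_form_diff_right:
  assumes "diffusion_tensor \<Omega> D m M" "g \<in> L2 \<Omega>" "h \<in> L2 \<Omega>" "h' \<in> L2 \<Omega>"
  shows "tensor_form \<Omega> D g (\<lambda>x. h x - h' x) = tensor_form \<Omega> D g h - tensor_form \<Omega> D g h'"
  using integrable_tensor_form[OF assms(1)] assms(2-)
  by (simp add: tensor_form_def inner_diff_right)

lemma
  assumes D: "diffusion_tensor \<Omega> D m M" and g: "g \<in> L2 \<Omega>"
  shows tensor_form_coercive: "m * (L2_norm \<Omega> g)\<^sup>2 \<le> tensor_form \<Omega> D g g"
    and tensor_form_bounded: "tensor_form \<Omega> D g g \<le> M * (L2_norm \<Omega> g)\<^sup>2"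
proof -
  have int: "integrable (lebesgue_on \<Omega>) (\<lambda>x. (norm (g x))\<^sup>2)"
    using g by (simp add: L2_def)
  note ae = diffusion_tensor_AE[OF D]
  have "(LINT x|lebesgue_on \<Omega>. m * (norm (g x))\<^sup>2) \<le> (LINT x|lebesgue_on \<Omega>. (D x *v g x) \<bullet> g x)"
    using int ae by (intro integral_mono_AE integrable_tensor_form[OF D] g) (auto elim: eventually_mono)
  then show "m * (L2_norm \<Omega> g)\<^sup>2 \<le> tensor_form \<Omega> D g g"
    by (simp add: L2_norm_sq tensor_form_def)
  have "(LINT x|lebesgue_on \<Omega>. (D x *v g x) \<bullet> g x) \<le> (LINT x|lebesgue_on \<Omega>. M * (norm (g x))\<^sup>2)"
    using int ae by (intro integral_mono_AE integrable_tensor_form[OF D] g) (auto elim: eventually_mono)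
  then show "tensor_form \<Omega> D g g \<le> M * (L2_norm \<Omega> g)\<^sup>2"
    by (simp add: L2_norm_sq tensor_form_def)
qed

lemma tensor_form_nonneg:
  assumes D: "diffusion_tensor \<Omega> D m M" and g: "g \<in> L2 \<Omega>"
  shows "0 \<le> tensor_form \<Omega> D g g"
proof -
  have "0 \<le> m * (L2_norm \<Omega> g)\<^sup>2"
    using D by (simp add: diffusion_tensor_def)
  then show ?thesis
    using tensor_form_coercive[OF assms] by linarith
qed

text \<open>The pointwise inequality is integrated for fixed \<open>t\<close>, and only then is
  \<open>t\<close> optimised, so no pointwise square roots occur.\<close>

lemma tensor_form_Cauchy_Schwarz:
  assumes D: "diffusion_tensor \<Omega> D m M" and g: "g \<in> L2 \<Omega>" and h: "h \<in> L2 \<Omega>"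
  shows "tensor_form \<Omega> D g h \<le> sqrt (tensor_form \<Omega> D g g) * sqrt (tensor_form \<Omega> D h h)"
proof (rule Cauchy_Schwarz_from_AM_GM)
  show "0 \<le> tensor_form \<Omega> D h h"
    by (rule tensor_form_nonneg[OF D h])
  fix t
  note int = integrable_tensor_form[OF D]
  have "AE x in lebesgue_on \<Omega>. 2 * t * ((D x *v g x) \<bullet> h x)
      \<le> (D x *v g x) \<bullet> g x + t\<^sup>2 * ((D x *v h x) \<bullet> h x)"
    using diffusion_tensor_AE[OF D] by eventually_elim (simp add: symmetric_matrix_AM_GM)
  then have "(LINT x|lebesgue_on \<Omega>. 2 * t * ((D x *v g x) \<bullet> h x))
      \<le> (LINT x|lebesgue_on \<Omega>. (D x *v g x) \<bullet> g x + t\<^sup>2 * ((D x *v h x) \<bullet> h x))"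
    by (intro integral_mono_AE integrable_mult_right Bochner_Integration.integrable_add int g h)
  then show "2 * t * tensor_form \<Omega> D g h \<le> tensor_form \<Omega> D g g + t\<^sup>2 * tensor_form \<Omega> D h h"
    using int[OF g g] int[OF h h] by (simp add: tensor_form_def)
qed

section \<open>The energy form and the energy norm on \<open>H1\<close>\<close>

lemma
  assumes "open \<Omega>" "diffusion_tensor \<Omega> D m M" "v \<in> H1 \<Omega>" "v' \<in> H1 \<Omega>" "w \<in> H1 \<Omega>"
  shows energy_form_diff_left:
      "energy_form \<Omega> D (\<lambda>x. v x - v' x) w = energy_form \<Omega> D v w - energy_form \<Omega> D v' w"
    and energy_form_diff_right:
      "energy_form \<Omega> D w (\<lambda>x. v x - v' x) = energy_form \<Omega> D w v - energy_form \<Omega> D w v'"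
proof -
  note L2 = H1_weak_grad_L2[OF assms(1)] H1_diff[OF assms(1)]
  have "energy_form \<Omega> D (\<lambda>x. v x - v' x) w
      = tensor_form \<Omega> D (\<lambda>x. weak_grad \<Omega> v x - weak_grad \<Omega> v' x) (weak_grad \<Omega> w)"
    unfolding energy_form_eq_tensor_form
    using assms L2 weak_grad_diff by (intro tensor_form_AE_cong[OF assms(2)] L2_diff) auto
  then show "energy_form \<Omega> D (\<lambda>x. v x - v' x) w = energy_form \<Omega> D v w - energy_form \<Omega> D v' w"
    using assms L2 by (simp add: tensor_form_diff_left energy_form_eq_tensor_form)
  have "energy_form \<Omega> D w (\<lambda>x. v x - v' x)
      = tensor_form \<Omega> D (weak_grad \<Omega> w) (\<lambda>x. weak_grad \<Omega> v x - weak_grad \<Omega> v' x)"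
    unfolding energy_form_eq_tensor_form
    using assms L2 weak_grad_diff by (intro tensor_form_AE_cong[OF assms(2)] L2_diff) auto
  then show "energy_form \<Omega> D w (\<lambda>x. v x - v' x) = energy_form \<Omega> D w v - energy_form \<Omega> D w v'"
    using assms L2 by (simp add: tensor_form_diff_right energy_form_eq_tensor_form)
qed

lemma energy_norm_nonneg:
  assumes "open \<Omega>" "diffusion_tensor \<Omega> D m M" "v \<in> H1 \<Omega>"
  shows "0 \<le> energy_norm \<Omega> D v"
  unfolding energy_norm_def energy_form_eq_tensor_form
  using tensor_form_nonneg[OF assms(2) H1_weak_grad_L2[OF assms(1,3)]] by simp

lemma energy_norm_sq:
  assumes "open \<Omega>" "diffusion_tensor \<Omega> D m M" "v \<in> H1 \<Omega>"
  shows "(energy_norm \<Omega> D v)\<^sup>2 = energy_form \<Omega> D v v"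
  unfolding energy_norm_def energy_form_eq_tensor_form
  using tensor_form_nonneg[OF assms(2) H1_weak_grad_L2[OF assms(1,3)]] by simp

lemma L2_norm_weak_grad_le_energy_norm:
  assumes "open \<Omega>" "diffusion_tensor \<Omega> D m M" "v \<in> H1 \<Omega>"
  shows "sqrt m * L2_norm \<Omega> (weak_grad \<Omega> v) \<le> energy_norm \<Omega> D v"
proof -
  have "sqrt (m * (L2_norm \<Omega> (weak_grad \<Omega> v))\<^sup>2) \<le> energy_norm \<Omega> D v"
    unfolding energy_norm_def energy_form_eq_tensor_form
    using tensor_form_coercive[OF assms(2) H1_weak_grad_L2[OF assms(1,3)]] by simp
  then show ?thesis
    by (simp add: real_sqrt_mult L2_norm_nonneg)
qed

text \<open>The energy is squeezed between 0 and \<open>M\<close> times the squared gradient norm.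
  This serves the degenerate case of the error estimate, in which the sign of
  \<open>C\<^sub>L\<close> cannot be recovered.\<close>

lemma energy_norm_eq_0:
  assumes "open \<Omega>" "diffusion_tensor \<Omega> D m M" "v \<in> H1 \<Omega>" "L2_norm \<Omega> (weak_grad \<Omega> v) = 0"
  shows "energy_norm \<Omega> D v = 0"
proof -
  have "energy_form \<Omega> D v v = 0"
    unfolding energy_form_eq_tensor_form
    using tensor_form_bounded[OF assms(2) H1_weak_grad_L2[OF assms(1,3)]]
      tensor_form_nonneg[OF assms(2) H1_weak_grad_L2[OF assms(1,3)]] assms(4) by simp
  then show ?thesis
    by (simp add: energy_norm_def)
qed

section \<open>Monotonicity and the Galerkin error estimate\<close>

lemma monotone_reaction_mult_nonneg:
  assumes "monotone_reaction \<Omega> b" "x \<in> \<Omega>"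
  shows "0 \<le> (b x s - b x t) * (s - t)"
proof -
  \<comment> \<open>Order 0 of the smoothness clause is differentiability of \<open>b x\<close>
    itself, so the sign of the derivative makes it nondecreasing.\<close>
  have diff: "(deriv ^^ 0) (b x) differentiable (at \<xi>)" and "deriv (b x) \<xi> \<ge> 0" for \<xi>
    using assms unfolding monotone_reaction_def by blast+
  then have "(b x has_real_derivative deriv (b x) \<xi>) (at \<xi>)" "deriv (b x) \<xi> \<ge> 0" for \<xi>
    using DERIV_deriv_iff_real_differentiable by auto
  then have "r \<le> r' \<Longrightarrow> b x r \<le> b x r'" for r r'
    by (meson DERIV_nonneg_imp_nondecreasing)
  then show ?thesis
    by (cases "s \<le> t") (auto intro: mult_nonneg_nonneg mult_nonpos_nonpos)
qed

text \<open>A lemma of Cea type. Inclusion in \<open>H10 \<Omega>\<close> lets elements of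
  \<open>V\<close> be tested in the continuous equation, and closure under differences makes
  \<open>v - u\<^sub>h\<close> admissible in the discrete one.\<close>

lemma quasi_optimality:
  fixes \<Omega> :: "(real^'d) set"
  assumes "open \<Omega>" and D: "diffusion_tensor \<Omega> D m M" and b: "monotone_reaction \<Omega> b"
    and V: "V \<subseteq> H10 \<Omega>" "\<And>v w. v \<in> V \<Longrightarrow> w \<in> V \<Longrightarrow> (\<lambda>x. v x - w x) \<in> V"
    and u: "galerkin_solution \<Omega> D b f (H10 \<Omega>) u"
    and uh: "galerkin_solution \<Omega> D b f V u\<^sub>h"
    and L: "\<forall>v\<in>H10 \<Omega>. pairing_exists \<Omega> (\<lambda>x. b x (u x) - b x (u\<^sub>h x)) v \<and>
           L2_inner \<Omega> (\<lambda>x. b x (u x) - b x (u\<^sub>h x)) v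
             \<le> C\<^sub>L * L2_norm \<Omega> (weak_grad \<Omega> (\<lambda>x. u x - u\<^sub>h x)) * L2_norm \<Omega> (weak_grad \<Omega> v)"
  shows "energy_norm \<Omega> D (\<lambda>x. u x - u\<^sub>h x)
           \<le> (1 + C\<^sub>L / m) * (INF v\<in>V. energy_norm \<Omega> D (\<lambda>x. u x - v x))"
proof -
  define e where "e = (\<lambda>x. u x - u\<^sub>h x)"
  define B where "B = (\<lambda>x. b x (u x) - b x (u\<^sub>h x))"
  define N where "N = L2_norm \<Omega> (weak_grad \<Omega> e)"
  have m: "m > 0"
    using D by (simp add: diffusion_tensor_def)
  have uH: "u \<in> H10 \<Omega>" and uhV: "u\<^sub>h \<in> V"
    using u uh by (auto simp: galerkin_solution_def)
  then have eH: "e \<in> H10 \<Omega>"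
    unfolding e_def using V(1) by (intro H10_diff[OF \<open>open \<Omega>\<close>]) auto
  have H10_H1: "v \<in> H10 \<Omega> \<Longrightarrow> v \<in> H1 \<Omega>" for v
    by (simp add: H10_def)
  have LB: "L2_inner \<Omega> B v \<le> C\<^sub>L * N * L2_norm \<Omega> (weak_grad \<Omega> v)"
    "integrable (lebesgue_on \<Omega>) (\<lambda>x. B x * v x)" if "v \<in> H10 \<Omega>" for v
    using L that by (auto simp: B_def N_def e_def pairing_exists_def)
  have Be: "0 \<le> L2_inner \<Omega> B e"
    unfolding L2_inner_def B_def e_def
    using monotone_reaction_mult_nonneg[OF b] by (intro Bochner_Integration.integral_nonneg) simp
  have zH: "(\<lambda>x. u x - v x) \<in> H10 \<Omega>" if "v \<in> V" for v
    using that uH V(1) by (intro H10_diff[OF \<open>open \<Omega>\<close>]) auto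
  have nonneg: "0 \<le> energy_norm \<Omega> D (\<lambda>x. u x - v x)" if "v \<in> V" for v
    by (intro energy_norm_nonneg[OF \<open>open \<Omega>\<close> D] H10_H1 zH that)
  \<comment> \<open>On the reals \<open>INF\<close> is a lower bound only if the set is bounded
    below.\<close>
  have bdd: "bdd_below ((\<lambda>v. energy_norm \<Omega> D (\<lambda>x. u x - v x)) ` V)"
    using nonneg by (intro bdd_belowI[of _ 0]) auto
  show ?thesis
  \<comment> \<open>\<open>C\<^sub>L \<ge> 0\<close> follows from \<open>LB\<close> and \<open>Be\<close> unless \<open>N = 0\<close>, in which case both sides vanish.\<close>
  proof (cases "N = 0")
    case True
    then have e0: "energy_norm \<Omega> D (\<lambda>x. u x - u\<^sub>h x) = 0"
      using energy_norm_eq_0[OF \<open>open \<Omega>\<close> D H10_H1[OF eH]] by (simp add: N_def e_def)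
    have "(INF v\<in>V. energy_norm \<Omega> D (\<lambda>x. u x - v x)) \<le> 0"
      using cINF_lower[OF bdd uhV] e0 by simp
    moreover have "0 \<le> (INF v\<in>V. energy_norm \<Omega> D (\<lambda>x. u x - v x))"
      using uhV nonneg by (intro cINF_greatest) auto
    ultimately show ?thesis
      using e0 by simp
  next
    case False
    then have "N > 0"
      using L2_norm_nonneg[of \<Omega> "weak_grad \<Omega> e"] by (simp add: N_def)
    moreover have "0 \<le> C\<^sub>L * N * N"
      using LB(1)[OF eH] Be by (simp add: N_def)
    ultimately have C: "0 \<le> C\<^sub>L"
      by (simp add: zero_le_mult_iff)
    have main: "energy_norm \<Omega> D e \<le> (1 + C\<^sub>L / m) * energy_norm \<Omega> D (\<lambda>x. u x - v x)" if v: "v \<in> V" for v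
    proof -
      define z where "z = (\<lambda>x. u x - v x)"
      define w where "w = (\<lambda>x. v x - u\<^sub>h x)"
      let ?E = "energy_norm \<Omega> D e" and ?Z = "energy_norm \<Omega> D z"
      \<comment> \<open>Two readings of \<open>w\<close>: as a difference of discrete functions it
        is a test function, as \<open>e\<close> minus \<open>z\<close> it splits both the energy
        form and the pairing with \<open>B\<close>.\<close>
      have w_eq: "w = (\<lambda>x. e x - z x)"
        by (simp add: w_def e_def z_def fun_eq_iff)
      have wV: "w \<in> V"
        unfolding w_def using V(2) v uhV by blast
      then have wH: "w \<in> H10 \<Omega>"
        using V(1) by blast
      have zH: "z \<in> H10 \<Omega>"
        unfolding z_def by (rule zH[OF v])
      note H1 = H10_H1[OF uH] H10_H1[OF eH] H10_H1[OF zH] H10_H1[OF wH]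
      have "energy_form \<Omega> D e w = energy_form \<Omega> D u w - energy_form \<Omega> D u\<^sub>h w"
        unfolding e_def using uhV V(1) by (intro energy_form_diff_left[OF \<open>open \<Omega>\<close> D] H1 H10_H1) auto
      also have "\<dots> = L2_inner \<Omega> (\<lambda>x. b x (u\<^sub>h x)) w - L2_inner \<Omega> (\<lambda>x. b x (u x)) w"
      proof -
        have "energy_form \<Omega> D u w + L2_inner \<Omega> (\<lambda>x. b x (u x)) w = L2_inner \<Omega> f w"
          "energy_form \<Omega> D u\<^sub>h w + L2_inner \<Omega> (\<lambda>x. b x (u\<^sub>h x)) w = L2_inner \<Omega> f w"
          using u uh wV wH by (auto simp: galerkin_solution_def)
        then show ?thesis by linarith
      qed
      \<comment> \<open>Combining the two pairings needs each of them to be integrable on its own,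
        which \<open>galerkin_solution\<close> records.\<close>
      also have "\<dots> = - L2_inner \<Omega> B w"
      proof -
        have "integrable (lebesgue_on \<Omega>) (\<lambda>x. b x (u x) * w x)"
          "integrable (lebesgue_on \<Omega>) (\<lambda>x. b x (u\<^sub>h x) * w x)"
          using u uh wV wH by (auto simp: galerkin_solution_def pairing_exists_def)
        then show ?thesis
          by (simp add: L2_inner_def B_def left_diff_distrib)
      qed
      also have "L2_inner \<Omega> B w = L2_inner \<Omega> B e - L2_inner \<Omega> B z"
        using LB(2)[OF eH] LB(2)[OF zH] by (simp add: w_eq L2_inner_def right_diff_distrib)
      finally have "energy_form \<Omega> D e w \<le> L2_inner \<Omega> B z"
        using Be by simp
      moreover have "energy_form \<Omega> D e w = energy_form \<Omega> D e e - energy_form \<Omega> D e z"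
        unfolding w_eq by (intro energy_form_diff_right[OF \<open>open \<Omega>\<close> D] H1)
      moreover have "energy_form \<Omega> D e z \<le> ?E * ?Z"
        unfolding energy_norm_def energy_form_eq_tensor_form
        by (intro tensor_form_Cauchy_Schwarz[OF D] H1_weak_grad_L2[OF \<open>open \<Omega>\<close>] H1)
      moreover have "L2_inner \<Omega> B z \<le> C\<^sub>L / m * (?E * ?Z)"
      proof -
        have "(sqrt m * N) * (sqrt m * L2_norm \<Omega> (weak_grad \<Omega> z)) \<le> ?E * ?Z"
          unfolding N_def using m
          by (intro mult_mono L2_norm_weak_grad_le_energy_norm[OF \<open>open \<Omega>\<close> D] H1
              energy_norm_nonneg[OF \<open>open \<Omega>\<close> D] mult_nonneg_nonneg L2_norm_nonneg) auto
        also have "(sqrt m * N) * (sqrt m * L2_norm \<Omega> (weak_grad \<Omega> z)) = m * (N * L2_norm \<Omega> (weak_grad \<Omega> z))"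
          using m by simp
        finally have "C\<^sub>L / m * (m * (N * L2_norm \<Omega> (weak_grad \<Omega> z))) \<le> C\<^sub>L / m * (?E * ?Z)"
          using C m by (intro mult_left_mono) auto
        moreover have "C\<^sub>L / m * (m * (N * L2_norm \<Omega> (weak_grad \<Omega> z))) = C\<^sub>L * N * L2_norm \<Omega> (weak_grad \<Omega> z)"
          using m by simp
        ultimately show ?thesis
          using LB(1)[OF zH] by linarith
      qed
      ultimately have "?E * ?E \<le> ?E * ((1 + C\<^sub>L / m) * ?Z)"
        using energy_norm_sq[OF \<open>open \<Omega>\<close> D H1(2)] by (simp add: power2_eq_square algebra_simps)
      \<comment> \<open>The factor \<open>?E\<close> can be cancelled only when it is positive; for
        \<open>?E = 0\<close> the claim is the nonnegativity of the right-hand side.\<close>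
      moreover have "0 \<le> ?E" "0 \<le> (1 + C\<^sub>L / m) * ?Z"
        using C m by (auto intro!: mult_nonneg_nonneg energy_norm_nonneg[OF \<open>open \<Omega>\<close> D] H1)
      ultimately show ?thesis
        unfolding z_def[symmetric] by (metis mult_le_cancel_left_pos order_le_less)
    qed
    have pos: "1 + C\<^sub>L / m > 0"
      using C m by (simp add: add_pos_nonneg)
    \<comment> \<open>Dividing by the positive constant isolates a lower bound independent of
      \<open>v\<close>, which passes to the infimum.\<close>
    have "energy_norm \<Omega> D e / (1 + C\<^sub>L / m) \<le> (INF v\<in>V. energy_norm \<Omega> D (\<lambda>x. u x - v x))"
      using uhV main pos by (intro cINF_greatest) (auto simp: pos_divide_le_eq mult.commute)
    then show ?thesis
      using pos unfolding e_def by (simp add: pos_divide_le_eq mult.commute)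
  qed
qed

theorem theorem3p2:
  fixes \<Omega> :: "(real^'d) set"
    and D :: "real^'d \<Rightarrow> real^'d^'d"
    and b :: "real^'d \<Rightarrow> real \<Rightarrow> real"
    and f u u\<^sub>h :: "real^'d \<Rightarrow> real"
    and H :: "real set" and \<T> :: "real \<Rightarrow> (real^'d) set set"
    and m M C\<^sub>L h :: real and k :: nat
  assumes "CARD('d) = 2 \<or> CARD('d) = 3"
    and "bounded_lipschitz_domain \<Omega>"
    and "diffusion_tensor \<Omega> D m M"
    and "f \<in> L2 \<Omega>"
    and "monotone_reaction \<Omega> b"
    and "quasi_uniform_triangulations \<Omega> H \<T>" and "h \<in> H" and "k \<ge> 1"
    and "galerkin_solution \<Omega> D b f (H10 \<Omega>) u"
    and "galerkin_solution \<Omega> D b f (fe_space \<Omega> (\<T> h) k) u\<^sub>h"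
    and "\<forall>v\<in>H10 \<Omega>. pairing_exists \<Omega> (\<lambda>x. b x (u x) - b x (u\<^sub>h x)) v \<and>
           L2_inner \<Omega> (\<lambda>x. b x (u x) - b x (u\<^sub>h x)) v
             \<le> C\<^sub>L * L2_norm \<Omega> (weak_grad \<Omega> (\<lambda>x. u x - u\<^sub>h x)) * L2_norm \<Omega> (weak_grad \<Omega> v)"
  shows "energy_norm \<Omega> D (\<lambda>x. u x - u\<^sub>h x)
           \<le> (1 + C\<^sub>L / m) * (INF v\<in>fe_space \<Omega> (\<T> h) k. energy_norm \<Omega> D (\<lambda>x. u x - v x))"

proof (rule quasi_optimality)
  show "open \<Omega>"
    using assms(2) by (simp add: bounded_lipschitz_domain_def)
  then show "(\<lambda>x. v x - w x) \<in> fe_space \<Omega> (\<T> h) k"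
    if "v \<in> fe_space \<Omega> (\<T> h) k" "w \<in> fe_space \<Omega> (\<T> h) k" for v w
    using that by (rule fe_space_diff)
  show "fe_space \<Omega> (\<T> h) k \<subseteq> H10 \<Omega>"
    by (auto simp: fe_space_def)
qed (fact assms)+

end
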